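(* Suppose that for some $1\le p,q_1,q_2\le\infty$, some $n\in\mathbb{N}_+=\{1,2,\dots\}$ and some $C>0$ the estimate $$\|Q^nf\|_{M^{p,q_1}(\mathbb{R}^{2d})}\le C\,\|Wf\|_{M^{p,q_2}(\mathbb{R}^{2d})}$$ holds for every $f\in\mathcal{S}(\mathbb{R}^d)$, where $Wf$ is the Wigner distribution and $Q^nf$ the Born--Jordan distribution of order $n$ of $f$. Then $q_1\ge q_2$.
   Context: Write $x\omega=x\cdot\omega$ for the scalar product in $\mathbb{R}^d$. The Wigner distribution of $f$ is $Wf(x,\omega)=\int_{\mathbb{R}^d} f(x+\frac y2)\overline{f(x-\frac y2)}e^{-2\pi i y\omega}\,dy$, $(x,\omega)\in\mathbb{R}^{2d}$. The symplectic form is $\sigma((x,\omega),(\zeta_1,\zeta_2))=\omega\cdot\zeta_1-x\cdot\zeta_2$, and the symplectic Fourier transform on $\mathbb{R}^{2d}$ is $\mathcal{F}_\sigma F(\zeta)=\int_{\mathbb{R}^{2d}}e^{-2\pi i\sigma(\zeta,z)}F(z)\,dz$ (extended to tempered distributions); it is an involution. Let $\mathrm{sinc}(t)=\frac{\sin(\pi t)}{\pi t}$ for $t\ne0$, $\mathrm{sinc}(0)=1$, and $\Theta^n(x,\omega)=\mathrm{sinc}^n(x\cdot\omega)$ on $\mathbb{R}^{2d}$. The Born--Jordan distribution of order $n$ is $Q^nf=Wf*\mathcal{F}_\sigma(\Theta^n)$; equivalently, $\mathcal{F}_\sigma(Q^nf)=\Theta^n\cdot\mathcal{F}_\sigma(Wf)$.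 Modulation spaces: for a fixed $g\in\mathcal{S}(\mathbb{R}^m)\setminus\{0\}$, let $V_gF(x,\omega)=\int_{\mathbb{R}^m}F(y)\overline{g(y-x)}e^{-2\pi i y\omega}\,dy$. $M^{p,q}(\mathbb{R}^m)$ is the space of $F\in\mathcal{S}'(\mathbb{R}^m)$ with $\|F\|_{M^{p,q}}=\big(\int(\int|V_gF(x,\omega)|^p\,dx)^{q/p}d\omega\big)^{1/q}<\infty$ (usual modification if $p=\infty$ or $q=\infty$); different $g$ give equivalent norms. *)

theory Defs
  imports "HOL-Analysis.Analysis" "HOL-Probability.Essential_Supremum"
begin

section \<open>Schwartz functions\<close>

text \<open>Iterated partial derivative along the list of directions \<open>bs\<close>.\<close>

fun partials :: "'a::euclidean_space list \<Rightarrow> ('a \<Rightarrow> complex) \<Rightarrow> 'a \<Rightarrow> complex" where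
  "partials [] f = f"
| "partials (b # bs) f = (\<lambda>x. frechet_derivative (partials bs f) (at x) b)"

text \<open>If all iterated partial derivatives are differentiable, they are all continuous,
  so the first conjunct expresses that \<open>f\<close> is infinitely differentiable.\<close>

definition schwartz :: "('a::euclidean_space \<Rightarrow> complex) \<Rightarrow> bool" where
  "schwartz f \<longleftrightarrow> (\<forall>bs. set bs \<subseteq> Basis \<longrightarrow>
     (\<forall>x. partials bs f differentiable (at x)) \<and>
     (\<forall>k::nat. \<exists>B. \<forall>x. norm x ^ k * norm (partials bs f x) \<le> B))"

section \<open>Distributions\<close>

text \<open>A tempered distribution is represented by its bilinear action on test functions; its values
  on functions that are not Schwartz are irrelevant. All distributions below are derived from
  functions of polynomial growth, so they are tempered.\<close>

type_synonym 'a distribution = "('a \<Rightarrow> complex) \<Rightarrow> complex"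

definition regular_distr :: "('a::euclidean_space \<Rightarrow> complex) \<Rightarrow> 'a distribution" where
  "regular_distr F = (\<lambda>\<phi>. \<integral>x. F x * \<phi> x \<partial>lborel)"

text \<open>Convolution of a Schwartz function with a tempered distribution, which is a function.\<close>

definition conv_distr :: "('a::euclidean_space \<Rightarrow> complex) \<Rightarrow> 'a distribution \<Rightarrow> 'a \<Rightarrow> complex" where
  "conv_distr \<phi> u = (\<lambda>z. u (\<lambda>w. \<phi> (z - w)))"

section \<open>Modulation spaces\<close>

text \<open>Real powers with positive exponent on \<open>[0,\<infinity>]\<close>.\<close>

definition epowr :: "ennreal \<Rightarrow> real \<Rightarrow> ennreal" where
  "epowr t a = (if t = \<infinity> then \<infinity> else ennreal (enn2real t powr a))"

definition Lp_norm :: "ennreal \<Rightarrow> ('a::euclidean_space \<Rightarrow> ennreal) \<Rightarrow> ennreal" where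
  "Lp_norm p h = (if p = \<infinity> then esssup lborel h
     else epowr (\<integral>\<^sup>+x. epowr (h x) (enn2real p) \<partial>lborel) (1 / enn2real p))"

definition stft :: "('a::euclidean_space \<Rightarrow> complex) \<Rightarrow> 'a distribution \<Rightarrow> 'a \<Rightarrow> 'a \<Rightarrow> complex" where
  "stft g u x \<omega> = u (\<lambda>y. cnj (g (y - x)) * exp (- 2 * pi * \<i> * (y \<bullet> \<omega>)))"

definition modulation_norm ::
  "('a::euclidean_space \<Rightarrow> complex) \<Rightarrow> ennreal \<Rightarrow> ennreal \<Rightarrow> 'a distribution \<Rightarrow> ennreal" where
  "modulation_norm g p q u = Lp_norm q (\<lambda>\<omega>. Lp_norm p (\<lambda>x. ennreal (norm (stft g u x \<omega>))))"

section \<open>Wigner and Born--Jordan distributions\<close>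

definition wigner :: "(real^'d \<Rightarrow> complex) \<Rightarrow> (real^'d) \<times> (real^'d) \<Rightarrow> complex" where
  "wigner f = (\<lambda>(x, \<omega>). \<integral>y. f (x + y /\<^sub>R 2) * cnj (f (x - y /\<^sub>R 2)) * exp (- 2 * pi * \<i> * (y \<bullet> \<omega>)) \<partial>lborel)"

definition symplectic_form :: "(real^'d) \<times> (real^'d) \<Rightarrow> (real^'d) \<times> (real^'d) \<Rightarrow> real" where
  "symplectic_form = (\<lambda>(x, \<omega>) (\<zeta>1, \<zeta>2). \<omega> \<bullet> \<zeta>1 - x \<bullet> \<zeta>2)"

definition symplectic_fourier ::
  "((real^'d) \<times> (real^'d) \<Rightarrow> complex) \<Rightarrow> (real^'d) \<times> (real^'d) \<Rightarrow> complex" where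
  "symplectic_fourier F \<zeta> = (\<integral>z. exp (- 2 * pi * \<i> * symplectic_form \<zeta> z) * F z \<partial>lborel)"

text \<open>Extension to distributions by duality. Since the symplectic form is antisymmetric, the transpose
  of the symplectic Fourier transform with respect to the bilinear pairing is
  \<open>\<phi> \<mapsto> (z \<mapsto> symplectic_fourier \<phi> (- z))\<close>.\<close>

definition symplectic_fourier_distr ::
  "((real^'d) \<times> (real^'d)) distribution \<Rightarrow> ((real^'d) \<times> (real^'d)) distribution" where
  "symplectic_fourier_distr u = (\<lambda>\<phi>. u (\<lambda>z. symplectic_fourier \<phi> (- z)))"

definition nsinc :: "real \<Rightarrow> real" where
  "nsinc t = (if t = 0 then 1 else sin (pi * t) / (pi * t))"

definition Theta :: "(real^'d) \<times> (real^'d) \<Rightarrow> complex" where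
  "Theta = (\<lambda>(x, \<omega>). complex_of_real (nsinc (x \<bullet> \<omega>)))"

definition born_jordan :: "nat \<Rightarrow> (real^'d \<Rightarrow> complex) \<Rightarrow> (real^'d) \<times> (real^'d) \<Rightarrow> complex" where
  "born_jordan n f =
     conv_distr (wigner f) (symplectic_fourier_distr (regular_distr (\<lambda>z. Theta z ^ n)))"

end

theory Submission
  imports Defs "HOL-Probability.Characteristic_Functions" "HOL-Probability.Sinc_Integral"
begin

text \<open>
  The estimate is tested on the Gaussians \<open>f x = exp (- \<pi> s\<^sup>2 \<bar>x\<bar>\<^sup>2)\<close> with \<open>s \<longlonglongrightarrow> \<infinity>\<close>. Up to a
  factor \<open>A\<close> that depends on \<open>s\<close> only, their Wigner distribution is a Gaussian of width \<open>1/s\<close> in \<open>x\<close> and \<open>s\<close> in \<open>\<omega>\<close>, whose modulation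
  norm is at most a constant times \<open>S\<close> to the power \<open>1/p + 1/q\<^sub>2 - 1\<close>, where \<open>S = s\<^sup>d\<close>. The function
  \<open>\<Theta>\<close> is invariant under \<open>(\<zeta>\<^sub>1, \<zeta>\<^sub>2) \<mapsto> (s \<zeta>\<^sub>1, \<zeta>\<^sub>2 / s)\<close>, so it affects all these Gaussians on the
  Fourier side in the same way. Hence the pairing of the Born--Jordan distribution with a Gaussian of the same
  shape is \<open>A\<close> times a constant independent of \<open>s\<close>, which is nonzero if the test Gaussian is chosen
  suitably. By duality of modulation norms, the Born--Jordan distribution has norm at least
  a constant times \<open>A\<close> times \<open>S\<close> to the power \<open>1/p + 1/q\<^sub>1 - 1\<close>. Letting \<open>s \<longlonglongrightarrow> \<infinity>\<close> gives
  \<open>1/q\<^sub>1 \<le> 1/q\<^sub>2\<close>.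
\<close>

section \<open>The Fourier transform\<close>

text \<open>The window is an arbitrary Schwartz function, so the short-time transforms have no
  closed form. They are bounded by a position profile times a frequency profile; the frequency part
  is where rapid decay of \<open>fourier g\<close> enters. Only powers of \<open>s\<close> matter,
  so constants are given away freely, as in the Hoelder inequality with factor 2.

  For odd \<open>n\<close> the multiplier changes sign, so its integral against a given Gaussian
  might vanish. On the Fourier side the product of the Wigner Gaussian and the test Gaussian has
  parameters \<open>b / s\<close> and \<open>b * s\<close>. Dilating to unit parameters divides the
  argument of \<open>nsinc\<close> by \<open>b * b\<close>, so the multiplier tends to 1 as
  \<open>b\<close> grows, and a suitable \<open>b\<close> makes the integral nonzero. The parameter
  \<open>a\<close> of the test Gaussian is then solved from \<open>b\<close>.

  The exponent \<open>p\<close> enters the upper bound through \<open>1/p\<close> and the duality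
  factor through \<open>-1/p\<close>, so it cancels and only the frequency exponents are compared.
  Infinite exponents obey the same formulas, because
  \<open>1 / enn2real \<infinity> = 1 / 0 = 0\<close>.\<close>

definition wave :: "real \<Rightarrow> complex" where
  "wave t = cis (2 * pi * t)"

lemma wave_0 [simp]: "wave 0 = 1"
  by (simp add: wave_def)

lemma norm_wave [simp]: "norm (wave t) = 1"
  by (simp add: wave_def)

lemma wave_add: "wave (a + b) = wave a * wave b"
  by (simp add: wave_def cis_mult distrib_left)

lemma wave_diff: "wave (a - b) = wave a * wave (- b)"
  using wave_add[of a "- b"] by simp

lemma cnj_wave [simp]: "cnj (wave t) = wave (- t)"
  by (simp add: wave_def cis_cnj)

lemma exp_eq_wave: "exp (complex_of_real (- 2 * pi) * \<i> * complex_of_real t) = wave (- t)"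
  by (simp add: wave_def cis_conv_exp mult_ac)

lemma continuous_on_wave [continuous_intros]:
  "continuous_on A f \<Longrightarrow> continuous_on A (\<lambda>x. wave (f x))"
  unfolding wave_def cis_conv_exp by (intro continuous_intros)

lemma measurable_wave [measurable]: "wave \<in> borel_measurable borel"
  by (intro borel_measurable_continuous_onI continuous_intros)

definition fourier :: "('a::euclidean_space \<Rightarrow> complex) \<Rightarrow> 'a \<Rightarrow> complex" where
  "fourier f \<xi> = (\<integral>x. f x * wave (- (x \<bullet> \<xi>)) \<partial>lborel)"

lemma fourier_measurable [measurable]:
  fixes f :: "'a::euclidean_space \<Rightarrow> complex"
  assumes [measurable]: "f \<in> borel_measurable borel"
  shows "fourier f \<in> borel_measurable borel"
  unfolding fourier_def by measurable

lemma norm_fourier_le: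
  "norm (fourier f \<xi>) \<le> (\<integral>x. norm (f x) \<partial>lborel)"
  unfolding fourier_def by (rule order_trans[OF integral_norm_bound]) (simp add: norm_mult)

lemma fourier_cmult: "fourier (\<lambda>x. c * f x) \<xi> = c * fourier f \<xi>"
  by (simp add: fourier_def mult.assoc)

lemma integrable_mult_wave [simp]:
  fixes f :: "'a::euclidean_space \<Rightarrow> complex"
  assumes "integrable lborel f" and [measurable]: "h \<in> borel_measurable borel"
  shows "integrable lborel (\<lambda>x. f x * wave (h x))"
proof -
  have [measurable]: "f \<in> borel_measurable borel" using assms(1) by auto
  show ?thesis by (rule Bochner_Integration.integrable_bound[OF assms(1)]) (auto simp: norm_mult)
qed

section \<open>Changes of variables and products for Lebesgue integrals\<close>

lemma lborel_scaleR:
  fixes f :: "'a::euclidean_space \<Rightarrow> ennreal"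
  assumes [measurable]: "f \<in> borel_measurable borel" and "c \<noteq> 0"
  shows "(\<integral>\<^sup>+x. f (c *\<^sub>R x) \<partial>lborel) = ennreal ((1 / \<bar>c\<bar>) ^ DIM('a)) * (\<integral>\<^sup>+x. f x \<partial>lborel)"
proof -
  have "(\<integral>\<^sup>+x. f (c *\<^sub>R x) \<partial>lborel) = (\<integral>\<^sup>+x. f (c *\<^sub>R x) \<partial>density (distr lborel borel (\<lambda>x. 0 + (1/c) *\<^sub>R x)) (\<lambda>_. \<bar>1/c\<bar>^DIM('a)))"
    by (subst lborel_affine[of "1/c" 0]) (use assms in auto)
  also have "\<dots> = ennreal ((1 / \<bar>c\<bar>) ^ DIM('a)) * (\<integral>\<^sup>+x. f x \<partial>lborel)"
    using assms(2) by (simp add: nn_integral_density nn_integral_distr nn_integral_cmult)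
  finally show ?thesis .
qed

lemma nn_integral_lborel_diff:
  fixes f :: "'a::euclidean_space \<Rightarrow> ennreal"
  assumes [measurable]: "f \<in> borel_measurable borel"
  shows "(\<integral>\<^sup>+x. f (x - z) \<partial>lborel) = (\<integral>\<^sup>+x. f x \<partial>lborel)"
  by (subst (2) lborel_distr_plus[of "- z", symmetric]) (simp add: nn_integral_distr)

lemma integral_lborel_plus:
  fixes f :: "'a::euclidean_space \<Rightarrow> complex"
  assumes [measurable]: "f \<in> borel_measurable borel"
  shows "(\<integral>x. f (z + x) \<partial>lborel) = (\<integral>x. f x \<partial>lborel)"
  by (subst (2) lborel_distr_plus[of z, symmetric]) (simp add: integral_distr)

lemma integrable_lborel_plus:
  fixes f :: "'a::euclidean_space \<Rightarrow> complex"
  assumes "integrable lborel f"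
  shows "integrable lborel (\<lambda>x. f (z + x))"
proof -
  have [measurable]: "f \<in> borel_measurable borel" using assms by auto
  show ?thesis using assms by (subst (asm) lborel_distr_plus[of z, symmetric]) (simp add: integrable_distr_eq)
qed

lemma distr_uminus_lborel: "distr lborel borel uminus = (lborel :: 'a::euclidean_space measure)"
proof -
  have "(lborel :: 'a measure) = density (distr lborel borel (\<lambda>x. 0 + (-1) *\<^sub>R x)) (\<lambda>_. ennreal (\<bar>-1\<bar>^DIM('a)))"
    by (rule lborel_affine) simp
  then show ?thesis by (simp add: density_1)
qed

lemma integral_lborel_minus:
  fixes f :: "'a::euclidean_space \<Rightarrow> complex"
  assumes [measurable]: "f \<in> borel_measurable borel"
  shows "(\<integral>x. f (z - x) \<partial>lborel) = (\<integral>x. f x \<partial>lborel)"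
proof -
  have "(\<integral>x. f (z - x) \<partial>lborel) = (\<integral>x. f (z + x) \<partial>distr lborel borel uminus)"
    by (subst integral_distr) auto
  then show ?thesis by (simp add: distr_uminus_lborel integral_lborel_plus)
qed

lemma integrable_lborel_minus:
  fixes f :: "'a::euclidean_space \<Rightarrow> complex"
  assumes "integrable lborel f"
  shows "integrable lborel (\<lambda>x. f (z - x))"
proof -
  have [measurable]: "f \<in> borel_measurable borel" using assms by auto
  have "integrable (distr lborel borel uminus) (\<lambda>x. f (z + x))"
    using integrable_lborel_plus[OF assms] by (simp add: distr_uminus_lborel)
  then show ?thesis by (subst (asm) integrable_distr_eq) auto
qed

text \<open>\<open>lborel\<close> is the image of the product measure over the coordinates, so
  Fubini applies coordinatewise. This reduces Gaussian Fourier integrals to dimension one.\<close>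

lemma has_bochner_integral_lborel_prod:
  fixes f :: "'a::euclidean_space \<Rightarrow> real \<Rightarrow> complex"
  assumes f: "\<And>b. b \<in> Basis \<Longrightarrow> has_bochner_integral lborel (f b) (I b)"
  shows "has_bochner_integral lborel (\<lambda>x. \<Prod>b\<in>Basis. f b (x \<bullet> b)) (\<Prod>b\<in>Basis. I b)"
proof -
  interpret product_sigma_finite "\<lambda>_::'a. lborel :: real measure" ..
  have int: "integrable lborel (f b)" if "b \<in> Basis" for b
    using f[OF that] by (simp add: has_bochner_integral_iff)
  have [measurable]: "f b \<in> borel_measurable borel" if "b \<in> Basis" for b
    using int[OF that] by auto
  have eq: "(\<Prod>b\<in>Basis. f b ((\<Sum>c\<in>Basis. x c *\<^sub>R c) \<bullet> b)) = (\<Prod>b\<in>Basis. f b (x b))" for x :: "'a \<Rightarrow> real"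
    by (intro prod.cong refl) simp
  have "integral\<^sup>L lborel (f b) = I b" if "b \<in> Basis" for b
    using f[OF that] by (simp add: has_bochner_integral_iff)
  then have "has_bochner_integral (\<Pi>\<^sub>M b\<in>Basis. lborel) (\<lambda>x. \<Prod>b\<in>Basis. f b (x b)) (\<Prod>b\<in>Basis. I b)"
    using product_integrable_prod[of "Basis::'a set" f] product_integral_prod[of "Basis::'a set" f] int
    by (simp add: has_bochner_integral_iff)
  then show ?thesis
    by (subst lborel_eq, intro has_bochner_integral_distr) (auto simp: eq)
qed

section \<open>Gaussians\<close>

text \<open>The factor \<open>pi\<close> makes the family closed under \<open>fourier\<close>: up to
  a scalar, \<open>t\<close> becomes \<open>1 / t\<close>. Larger \<open>t\<close> means a narrower
  Gaussian.\<close>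

definition gauss :: "real \<Rightarrow> 'a::euclidean_space \<Rightarrow> real" where
  "gauss t x = exp (- (pi * (t * norm x)\<^sup>2))"

lemma gauss_pos [simp]: "0 < gauss t x" "0 \<le> gauss t x"
  by (simp_all add: gauss_def)

lemma continuous_on_gauss [continuous_intros]:
  "continuous_on A f \<Longrightarrow> continuous_on A (\<lambda>x. gauss t (f x))"
  unfolding gauss_def by (intro continuous_intros)

lemma measurable_gauss [measurable]: "gauss t \<in> borel_measurable borel"
  by (intro borel_measurable_continuous_onI continuous_intros)

lemma gauss_scaleR: "gauss t (c *\<^sub>R x) = gauss (t * c) x"
  by (simp add: gauss_def power_mult_distrib)

lemma gauss_minus [simp]: "gauss t (- x) = gauss t x"
  by (simp add: gauss_def)

lemma gauss_prod: "gauss t (x :: 'a::euclidean_space) = (\<Prod>b\<in>Basis. gauss t (x \<bullet> b))"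
proof -
  have "(t * norm x)\<^sup>2 = (\<Sum>b\<in>Basis. (t * (x \<bullet> b))\<^sup>2)"
    unfolding power_mult_distrib power2_norm_eq_inner euclidean_inner[of x x]
    by (simp add: sum_distrib_left power2_eq_square)
  then show ?thesis
    by (simp add: gauss_def exp_sum sum_distrib_left power_mult_distrib flip: sum_negf)
qed

text \<open>Substituting \<open>x = c * u\<close> with \<open>c = 1 / (t * sqrt (2 * pi))\<close>
  turns the Gaussian into a multiple of the standard normal density, whose characteristic function
  is known.\<close>

lemma fourier_gauss_real:
  assumes t: "0 < t"
  shows "has_bochner_integral lborel (\<lambda>x::real. of_real (gauss t x) * wave (- (x * \<xi>)))
    (of_real ((1 / t) * gauss (1 / t) \<xi>))"
proof -
  define c where "c = 1 / (t * sqrt (2 * pi))"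
  have c: "c > 0" using t by (simp add: c_def)
  have c2: "pi * (t * c)\<^sup>2 = 1 / 2" using t by (simp add: c_def power_divide power_mult_distrib field_simps)
  define h where "h = (\<lambda>x::real. of_real (gauss t x) * wave (- (x * \<xi>)))"
  have h: "h (0 + c * u) = of_real (sqrt (2 * pi)) * (std_normal_density u *\<^sub>R iexp ((- 2 * pi * c * \<xi>) * u))" for u
  proof -
    have "pi * (t * norm (c * u))\<^sup>2 = (pi * (t * c)\<^sup>2) * u\<^sup>2" by (simp add: power_mult_distrib)
    then have "gauss t (c * u) = exp (- u\<^sup>2 / 2)" unfolding gauss_def c2 by simp
    then show ?thesis
      by (simp add: h_def std_normal_density_def scaleR_conv_of_real wave_def cis_conv_exp mult_ac real_sqrt_mult)
  qed
  have ch: "(\<integral>u. std_normal_density u *\<^sub>R iexp (y * u) \<partial>lborel) = of_real (exp (- (y^2) / 2))" for y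
    using char_std_normal_distribution[THEN fun_cong, of y]
    by (simp add: char_def integral_density)
  have int: "integrable lborel (\<lambda>u. std_normal_density u *\<^sub>R iexp (y * u))" for y
    by (rule Bochner_Integration.integrable_bound[OF integrable_normal_density[of 1 0]]) auto
  have "integrable lborel (\<lambda>u. h (0 + c * u))"
    unfolding h by (intro integrable_mult_right int)
  then have 1: "integrable lborel h" using c by (subst (asm) lborel_integrable_real_affine_iff) auto
  have 2: "integral\<^sup>L lborel h = \<bar>c\<bar> *\<^sub>R (\<integral>u. h (0 + c * u) \<partial>lborel)"
    using c by (intro lborel_integral_real_affine) auto
  also have "(\<integral>u. h (0 + c * u) \<partial>lborel) = of_real (sqrt (2 * pi)) * of_real (exp (- ((- 2 * pi * c * \<xi>)^2) / 2))"
    unfolding h ch[symmetric] by (rule Bochner_Integration.integral_mult_right) (rule int)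
  also have "- ((- 2 * pi * c * \<xi>)^2) / 2 = - (pi * ((1/t) * norm \<xi>)\<^sup>2)"
    using t by (simp add: c_def power_divide power_mult_distrib field_simps power2_eq_square)
  finally have "integral\<^sup>L lborel h = of_real (\<bar>c\<bar> * sqrt (2 * pi) * gauss (1 / t) \<xi>)"
    by (simp add: gauss_def scaleR_conv_of_real)
  also have "\<bar>c\<bar> * sqrt (2 * pi) = 1 / t" using t by (simp add: c_def)
  finally show ?thesis using 1 by (simp add: has_bochner_integral_iff h_def)
qed

lemma has_bochner_integral_gauss_wave:
  fixes \<xi> :: "'a::euclidean_space"
  assumes t: "0 < t"
  shows "has_bochner_integral lborel (\<lambda>x::'a. of_real (gauss t x) * wave (- (x \<bullet> \<xi>)))
    (of_real ((1 / t) ^ DIM('a) * gauss (1 / t) \<xi>))"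
proof -
  have wave_sum: "wave (\<Sum>b\<in>B. g b) = (\<Prod>b\<in>B. wave (g b))" for g and B :: "'a set"
    by (induction B rule: infinite_finite_induct) (auto simp: wave_add)
  have 1: "of_real (gauss t x) * wave (- (x \<bullet> \<xi>)) =
     (\<Prod>b\<in>Basis. of_real (gauss t (x \<bullet> b)) * wave (- ((x \<bullet> b) * (\<xi> \<bullet> b))))" for x :: 'a
    unfolding gauss_prod[of t x] euclidean_inner[of x \<xi>] by (simp add: prod.distrib wave_sum flip: sum_negf)
  have 2: "of_real ((1 / t) ^ DIM('a) * gauss (1 / t) \<xi>) =
     (\<Prod>b\<in>Basis. complex_of_real (1 / t * gauss (1 / t) (\<xi> \<bullet> b)))"
    by (subst gauss_prod) (simp add: prod.distrib prod_dividef power_divide)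
  show ?thesis
    unfolding 1 2 by (intro has_bochner_integral_lborel_prod fourier_gauss_real t)
qed

lemma fourier_gauss:
  fixes \<xi> :: "'a::euclidean_space"
  assumes "0 < t"
  shows "fourier (\<lambda>x. of_real (gauss t x)) \<xi> = of_real ((1 / t) ^ DIM('a) * gauss (1 / t) \<xi>)"
  unfolding fourier_def using has_bochner_integral_gauss_wave[OF assms] by (rule has_bochner_integral_integral_eq)

lemma integrable_gauss:
  assumes "0 < t"
  shows "integrable lborel (gauss t :: 'a::euclidean_space \<Rightarrow> real)"
proof -
  have "integrable lborel (\<lambda>x. complex_of_real (gauss t (x :: 'a)))"
    using has_bochner_integral_gauss_wave[OF assms, of "0::'a"] by (simp add: has_bochner_integral_iff)
  then show ?thesis by (subst (asm) complex_of_real_integrable_eq) 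
qed

section \<open>Decay of Schwartz functions and their Fourier transforms\<close>

text \<open>A product over coordinates instead of a power of the norm: its reciprocal can be
  integrated coordinate by coordinate, and it splits over pairs, so the two halves of phase space
  can be scaled separately.\<close>

definition weight :: "'a::euclidean_space \<Rightarrow> real" where
  "weight x = (\<Prod>b\<in>Basis. 1 + (x \<bullet> b)\<^sup>2)"

lemma weight_ge_1: "1 \<le> weight x"
  unfolding weight_def by (intro prod_ge_1) simp

lemma weight_pos [simp]: "0 < weight x" "0 \<le> weight x" "weight x \<noteq> 0"
  using weight_ge_1[of x] by linarith+

lemma weight_minus [simp]: "weight (- x) = weight x"
  by (simp add: weight_def)

lemma continuous_on_weight [continuous_intros]:
  "continuous_on A f \<Longrightarrow> continuous_on A (\<lambda>x. weight (f x))"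
  unfolding weight_def by (intro continuous_intros)

lemma measurable_weight [measurable]: "weight \<in> borel_measurable borel"
  by (intro borel_measurable_continuous_onI continuous_intros)

text \<open>Peetre's inequality in each coordinate: with \<open>u\<close> and \<open>v\<close> as
  below, the right side minus the left is \<open>1 + (u - v)^2 + 2 * (u * v)^2\<close>.\<close>

lemma weight_le_mult:
  fixes x y :: "'a::euclidean_space"
  shows "weight x \<le> 2 ^ DIM('a) * weight y * weight (x - y)"
proof -
  have "1 + (x \<bullet> b)\<^sup>2 \<le> 2 * (1 + (y \<bullet> b)\<^sup>2) * (1 + ((x - y) \<bullet> b)\<^sup>2)" for b
  proof -
    define u v where "u = y \<bullet> b" and "v = (x - y) \<bullet> b"
    have "x \<bullet> b = u + v" by (simp add: u_def v_def inner_diff_left)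
    moreover have "1 + (u + v)\<^sup>2 \<le> 2 * (1 + u\<^sup>2) * (1 + v\<^sup>2)"
      using zero_le_power2[of "u - v"] zero_le_power2[of "u * v"]
      by (simp add: power2_eq_square algebra_simps)
    ultimately show ?thesis by (simp add: u_def v_def)
  qed
  then have "weight x \<le> (\<Prod>b\<in>(Basis::'a set). 2 * (1 + (y \<bullet> b)\<^sup>2) * (1 + ((x - y) \<bullet> b)\<^sup>2))"
    unfolding weight_def by (intro prod_mono) auto
  then show ?thesis unfolding weight_def prod.distrib by simp
qed

lemma weight_scaleR_mono:
  assumes "\<bar>c\<bar> \<le> \<bar>d\<bar>"
  shows "weight (c *\<^sub>R x) \<le> weight (d *\<^sub>R x)"
proof -
  have "c\<^sup>2 \<le> d\<^sup>2" using assms by (simp only: abs_le_square_iff)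
  then have "(c * u)\<^sup>2 \<le> (d * u)\<^sup>2" for u
    unfolding power_mult_distrib by (intro mult_right_mono) auto
  then show ?thesis unfolding weight_def by (intro prod_mono) auto
qed

lemma weight_Pair: "weight (x, y) = weight x * weight y"
proof -
  have "weight (x, y) = (\<Prod>b\<in>(\<lambda>u. (u, 0)) ` Basis. 1 + ((x, y) \<bullet> b)\<^sup>2) * (\<Prod>b\<in>Pair 0 ` Basis. 1 + ((x, y) \<bullet> b)\<^sup>2)"
    unfolding weight_def Basis_prod_def by (subst prod.union_disjoint) auto
  also have "\<dots> = weight x * weight y"
    unfolding weight_def by (subst (1 2) prod.reindex) (auto simp: inj_on_def)
  finally show ?thesis .
qed

lemma nn_integral_inverse_weight:
  "(\<integral>\<^sup>+x. ennreal (1 / weight (x :: 'a::euclidean_space)) \<partial>lborel) = ennreal (pi ^ DIM('a))"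
proof -
  have int: "integrable lborel (\<lambda>x::real. inverse (1 + x\<^sup>2))"
    using integrable_inverse_1_plus_square by (simp add: set_integrable_def)
  have "(\<integral>x. inverse (1 + (x::real)\<^sup>2) \<partial>lborel) = pi"
    using LBINT_inverse_1_plus_square by (simp add: interval_lebesgue_integral_def set_lebesgue_integral_def)
  then have 1: "(\<integral>\<^sup>+x. ennreal (inverse (1 + (x::real)\<^sup>2)) \<partial>lborel) = ennreal pi"
    by (subst nn_integral_eq_integral[OF int]) auto
  have "(\<integral>\<^sup>+x. ennreal (1 / weight (x :: 'a)) \<partial>lborel) =
      (\<integral>\<^sup>+x. (\<Prod>b\<in>(Basis::'a set). ennreal (inverse (1 + (x \<bullet> b)\<^sup>2))) \<partial>lborel)"
    by (intro nn_integral_cong) (simp add: weight_def prod_ennreal prod_inversef[unfolded o_def] divide_inverse)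
  also have "\<dots> = (\<Prod>b\<in>(Basis::'a set). ennreal pi)"
    by (subst nn_integral_lborel_prod) (auto simp: 1)
  finally show ?thesis by (simp add: ennreal_power)
qed

lemma integrable_inverse_weight: "integrable lborel (\<lambda>x. 1 / weight (x :: 'a::euclidean_space))"
  by (rule integrableI_nn_integral_finite[OF _ _ nn_integral_inverse_weight]) auto

lemma weight_le_norm: "weight (x :: 'a::euclidean_space) \<le> (1 + (norm x)\<^sup>2) ^ DIM('a)"
proof -
  have "(x \<bullet> b)\<^sup>2 \<le> (norm x)\<^sup>2" if "b \<in> Basis" for b
    using Basis_le_norm[OF that, of x] by (simp add: abs_le_square_iff[symmetric])
  then have "weight x \<le> (\<Prod>b\<in>(Basis::'a set). 1 + (norm x)\<^sup>2)"
    unfolding weight_def by (intro prod_mono) auto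
  then show ?thesis by simp
qed

text \<open>The decay part of \<open>schwartz\<close> without derivatives, so that it can be stated
  for \<open>fourier g\<close> without differentiating under the integral.\<close>

definition rapid :: "('a::euclidean_space \<Rightarrow> complex) \<Rightarrow> bool" where
  "rapid f \<longleftrightarrow> (\<forall>k::nat. \<exists>B. \<forall>x. norm x ^ k * norm (f x) \<le> B)"

text \<open>A power of \<open>weight\<close> is at most a constant times
  \<open>1 + norm x ^ (2 * m)\<close>, so the decay bounds for the exponents \<open>0\<close> and
  \<open>2 * m\<close> suffice. The extra 1 in the witness makes it positive.\<close>

lemma rapid_weight:
  fixes f :: "'a::euclidean_space \<Rightarrow> complex"
  assumes "rapid f"
  obtains B where "0 < B" "\<And>x. weight x ^ k * norm (f x) \<le> B"
proof -
  define m where "m = DIM('a) * k"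
  obtain B0 B1 where B: "\<And>x. norm x ^ 0 * norm (f x) \<le> B0" "\<And>x. norm x ^ (2 * m) * norm (f x) \<le> B1"
    using assms unfolding rapid_def by metis
  have "weight x ^ k * norm (f x) \<le> 2 ^ m * (\<bar>B0\<bar> + \<bar>B1\<bar>) + 1" for x
  proof -
    have "weight x ^ k \<le> (1 + (norm x)\<^sup>2) ^ m"
      unfolding m_def power_mult by (intro power_mono weight_le_norm) auto
    also have "\<dots> \<le> 2 ^ m * (1 + norm x ^ (2 * m))"
    proof (cases "norm x \<le> 1")
      case True
      then have "(1 + (norm x)\<^sup>2) ^ m \<le> 2 ^ m * 1"
        by (simp, intro power_mono) (auto simp: power_le_one)
      also have "\<dots> \<le> 2 ^ m * (1 + norm x ^ (2 * m))" by (intro mult_left_mono) auto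
      finally show ?thesis .
    next
      case False
      then have "1 \<le> (norm x)\<^sup>2" by (intro one_le_power) auto
      then have "(1 + (norm x)\<^sup>2) ^ m \<le> (2 * (norm x)\<^sup>2) ^ m"
        by (intro power_mono) auto
      also have "\<dots> \<le> 2 ^ m * (1 + norm x ^ (2 * m))" by (simp add: power_mult_distrib power_mult)
      finally show ?thesis .
    qed
    finally have "weight x ^ k * norm (f x) \<le> 2 ^ m * (1 + norm x ^ (2 * m)) * norm (f x)"
      by (rule mult_right_mono) auto
    also have "\<dots> = 2 ^ m * (norm x ^ 0 * norm (f x) + norm x ^ (2 * m) * norm (f x))"
      by (simp add: algebra_simps)
    also have "\<dots> \<le> 2 ^ m * (\<bar>B0\<bar> + \<bar>B1\<bar>)"
      using B(1)[of x] B(2)[of x] by (intro mult_left_mono add_mono) auto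
    finally show ?thesis by simp
  qed
  then show ?thesis by (intro that[of "2 ^ m * (\<bar>B0\<bar> + \<bar>B1\<bar>) + 1"]) (auto intro: add_nonneg_pos)
qed

lemma norm_le_inverse_weight:
  assumes "rapid f"
  obtains B where "0 < B" "\<And>x. norm (f x) \<le> B * (1 / weight x)"
proof -
  obtain B where B: "0 < B" "\<And>x. weight x ^ 1 * norm (f x) \<le> B" using rapid_weight[OF assms] by blast
  show ?thesis
    using B(2) by (intro that[OF B(1)]) (simp add: le_divide_eq mult.commute)
qed

lemma rapid_integrable:
  assumes "rapid f" and [measurable]: "f \<in> borel_measurable borel"
  shows "integrable lborel f"
proof -
  obtain B where B: "0 < B" "\<And>x. norm (f x) \<le> B * (1 / weight x)"
    using norm_le_inverse_weight[OF assms(1)] by blast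
  have "integrable lborel (\<lambda>x. B * (1 / weight x))" by (intro integrable_mult_right integrable_inverse_weight)
  then show ?thesis
    by (rule Bochner_Integration.integrable_bound) (use B in \<open>auto intro!: always_eventually order_trans[OF _ abs_ge_self]\<close>)
qed

lemma partials_append: "partials (bs @ cs) f = partials bs (partials cs f)"
  by (induction bs) auto

lemma schwartz_partials:
  assumes "schwartz f" "set cs \<subseteq> Basis"
  shows "schwartz (partials cs f)"
  unfolding schwartz_def
proof (intro allI impI)
  fix bs :: "'a list" assume "set bs \<subseteq> Basis"
  then have "set (bs @ cs) \<subseteq> Basis" using assms by auto
  with assms(1) show "(\<forall>x. partials bs (partials cs f) differentiable at x) \<and>
        (\<forall>k::nat. \<exists>B. \<forall>x. norm x ^ k * norm (partials bs (partials cs f) x) \<le> B)"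
    unfolding schwartz_def partials_append[symmetric] by blast
qed

lemma schwartz_differentiable: "schwartz f \<Longrightarrow> f differentiable (at x)"
  unfolding schwartz_def by (drule spec[of _ "[]"]) auto

lemma schwartz_rapid: "schwartz f \<Longrightarrow> rapid f"
  unfolding schwartz_def rapid_def by (drule spec[of _ "[]"]) auto

lemma schwartz_continuous: "schwartz f \<Longrightarrow> continuous_on A f"
  by (intro continuous_at_imp_continuous_on ballI differentiable_imp_continuous_within schwartz_differentiable)

lemma schwartz_measurable: "schwartz f \<Longrightarrow> f \<in> borel_measurable borel"
  by (intro borel_measurable_continuous_onI schwartz_continuous)

lemma schwartz_integrable: "schwartz f \<Longrightarrow> integrable lborel f"
  by (intro rapid_integrable schwartz_rapid schwartz_measurable)

text \<open>The step sizes form a sequence because dominated convergence will be applied along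
  \<open>n\<close>.\<close>

lemma has_vector_derivative_quotient_limit:
  fixes f :: "real \<Rightarrow> complex"
  assumes "(f has_vector_derivative D) (at 0)"
  shows "(\<lambda>n. (f (1 / Suc n) - f 0) / of_real (1 / Suc n)) \<longlonglongrightarrow> D"
proof -
  have "((\<lambda>h. norm (f (0 + h) - f 0 - h *\<^sub>R D) / norm h) \<longlongrightarrow> 0) (at 0)"
    using assms unfolding has_vector_derivative_def has_derivative_at by blast
  moreover have "norm (f (0 + h) - f 0 - h *\<^sub>R D) / norm h = norm ((f h - f 0) / of_real h - D)" if "h \<noteq> 0" for h
  proof -
    have "(f h - f 0) / of_real h - D = (f (0 + h) - f 0 - h *\<^sub>R D) / of_real h"
      using that by (simp add: diff_divide_distrib scaleR_conv_of_real)
    then show ?thesis by (simp add: norm_divide)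
  qed
  then have "\<forall>\<^sub>F h in at 0. norm (f (0 + h) - f 0 - h *\<^sub>R D) / norm h = norm ((f h - f 0) / of_real h - D)"
    unfolding eventually_at_filter by (intro always_eventually) auto
  ultimately have "((\<lambda>h. norm ((f h - f 0) / of_real h - D)) \<longlongrightarrow> 0) (at 0)"
    by (rule Lim_transform_eventually)
  then have "((\<lambda>h. (f h - f 0) / of_real h) \<longlongrightarrow> D) (at 0)"
    by (rule LIM_zero_cancel[OF tendsto_norm_zero_cancel])
  moreover have "filterlim (\<lambda>n. 1 / real (Suc n)) (at 0) sequentially"
    unfolding filterlim_at using LIMSEQ_inverse_real_of_nat by (auto simp: inverse_eq_divide)
  ultimately show ?thesis by (rule filterlim_compose)
qed

text \<open>Passing to the limit in the difference quotients, which are dominated by the mean value theorem.\<close>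

lemma fourier_partial:
  fixes f :: "'a::euclidean_space \<Rightarrow> complex"
  assumes f: "schwartz f" and b: "b \<in> Basis"
  shows "fourier (partials [b] f) \<xi> = 2 * pi * \<i> * (\<xi> \<bullet> b) * fourier f \<xi>"
proof -
  define D where "D = partials [b] f"
  have D: "schwartz D" unfolding D_def using assms by (intro schwartz_partials) auto
  have [measurable]: "D \<in> borel_measurable borel" "f \<in> borel_measurable borel"
    using D f by (auto intro: schwartz_measurable)
  obtain B where B: "0 < B" "\<And>x. norm (D x) \<le> B * (1 / weight x)"
    using norm_le_inverse_weight schwartz_rapid D by blast
  have der: "((\<lambda>t. f (x + t *\<^sub>R b)) has_vector_derivative D (x + t *\<^sub>R b)) (at t)" for x t
  proof -
    have "(f has_derivative frechet_derivative f (at (x + t *\<^sub>R b))) (at (x + t *\<^sub>R b))"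
      using f by (simp add: frechet_derivative_works[symmetric] schwartz_differentiable)
    then have "((\<lambda>t. f (x + t *\<^sub>R b)) has_derivative (\<lambda>h. frechet_derivative f (at (x + t *\<^sub>R b)) (h *\<^sub>R b))) (at t)"
      by (intro has_derivative_compose[where f="\<lambda>t. x + t *\<^sub>R b" and g=f]) (auto intro!: derivative_eq_intros)
    moreover have "linear (frechet_derivative f (at (x + t *\<^sub>R b)))"
      using f by (intro linear_frechet_derivative schwartz_differentiable)
    ultimately show ?thesis by (simp add: has_vector_derivative_def D_def linear_cmul)
  qed
  define q where "q = (\<lambda>n x. (f (x + (1 / Suc n) *\<^sub>R b) - f x) / of_real (1 / Suc n))"
  have lim: "(\<lambda>n. q n x) \<longlonglongrightarrow> D x" for x
    using has_vector_derivative_quotient_limit[OF der[of x 0]] by (simp add: q_def)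
  \<comment> \<open>An integrable majorant uniform in \<open>n\<close>: the step is at most 1, so
    \<open>weight_le_mult\<close> compares \<open>weight\<close> along the segment with
    \<open>weight x\<close> at the price of the factor \<open>weight b\<close>.\<close>
  have bound: "norm (q n x) \<le> 2 ^ DIM('a) * weight b * B * (1 / weight x)" for n x
  proof -
    define t where "t = 1 / real (Suc n)"
    have t: "0 < t" "t \<le> 1" by (auto simp: t_def)
    have Db: "norm (D (x + \<theta> *\<^sub>R b)) \<le> 2 ^ DIM('a) * weight b * B * (1 / weight x)" if "\<theta> \<in> {0..t}" for \<theta>
    proof -
      have "weight x \<le> 2 ^ DIM('a) * weight (x + \<theta> *\<^sub>R b) * weight (x - (x + \<theta> *\<^sub>R b))"
        by (rule weight_le_mult)
      also have "weight (x - (x + \<theta> *\<^sub>R b)) = weight (\<theta> *\<^sub>R b)" by simp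
      also have "\<dots> \<le> weight (1 *\<^sub>R b)" using that t by (intro weight_scaleR_mono) auto
      finally have "weight x \<le> 2 ^ DIM('a) * weight (x + \<theta> *\<^sub>R b) * weight b" by simp
      then have "1 / weight (x + \<theta> *\<^sub>R b) \<le> 2 ^ DIM('a) * weight b * (1 / weight x)"
        by (simp add: field_simps)
      then have "B * (1 / weight (x + \<theta> *\<^sub>R b)) \<le> B * (2 ^ DIM('a) * weight b * (1 / weight x))"
        using B(1) by (intro mult_left_mono) auto
      then show ?thesis using B(2)[of "x + \<theta> *\<^sub>R b"] by (simp add: mult_ac)
    qed
    have "norm (f (x + t *\<^sub>R b) - f (x + 0 *\<^sub>R b)) \<le> 2 ^ DIM('a) * weight b * B * (1 / weight x) * norm (t - 0)"
    proof (rule differentiable_bound[of "{0..t}" "\<lambda>t. f (x + t *\<^sub>R b)" "\<lambda>\<theta> h. h *\<^sub>R D (x + \<theta> *\<^sub>R b)"])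
      show "((\<lambda>t. f (x + t *\<^sub>R b)) has_derivative (\<lambda>h. h *\<^sub>R D (x + \<theta> *\<^sub>R b))) (at \<theta> within {0..t})" for \<theta>
        using der[of x \<theta>] unfolding has_vector_derivative_def by (rule has_derivative_at_withinI)
      show "onorm (\<lambda>h. h *\<^sub>R D (x + \<theta> *\<^sub>R b)) \<le> 2 ^ DIM('a) * weight b * B * (1 / weight x)" if "\<theta> \<in> {0..t}" for \<theta>
        using mult_left_mono[OF Db[OF that] abs_ge_zero] by (intro onorm_le) (simp add: mult.commute)
    qed (use t in auto)
    then have "norm (f (x + t *\<^sub>R b) - f x) / t \<le> 2 ^ DIM('a) * weight b * B * (1 / weight x)"
      using t by (simp add: divide_le_eq)
    then show ?thesis using t unfolding q_def t_def[symmetric] by (simp add: norm_divide)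
  qed
  have int: "integrable lborel f" using f by (rule schwartz_integrable)
  have "(\<lambda>n. \<integral>x. q n x * wave (- (x \<bullet> \<xi>)) \<partial>lborel) \<longlonglongrightarrow> (\<integral>x. D x * wave (- (x \<bullet> \<xi>)) \<partial>lborel)"
  proof (rule integral_dominated_convergence[where w="\<lambda>x. 2 ^ DIM('a) * weight b * B * (1 / weight x)"])
    show "integrable lborel (\<lambda>x::'a. 2 ^ DIM('a) * weight b * B * (1 / weight x))"
      by (intro integrable_mult_right integrable_inverse_weight)
    show "AE x in lborel. (\<lambda>n. q n x * wave (- (x \<bullet> \<xi>))) \<longlonglongrightarrow> D x * wave (- (x \<bullet> \<xi>))"
      by (intro always_eventually allI tendsto_intros lim)
    show "AE x in lborel. norm (q n x * wave (- (x \<bullet> \<xi>))) \<le> 2 ^ DIM('a) * weight b * B * (1 / weight x)" for n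
      using bound[of n] by (simp only: norm_mult norm_wave mult_1_right) simp
    show "(\<lambda>x. q n x * wave (- (x \<bullet> \<xi>))) \<in> borel_measurable lborel" for n
      unfolding q_def by measurable
  qed simp
  moreover have "(\<integral>x. q n x * wave (- (x \<bullet> \<xi>)) \<partial>lborel) = (wave ((1 / Suc n) * (b \<bullet> \<xi>)) - wave (0 * (b \<bullet> \<xi>))) / of_real (1 / Suc n) * fourier f \<xi>" for n
  proof -
    define t where "t = 1 / real (Suc n)"
    define v where "v = t *\<^sub>R b"
    \<comment> \<open>Translation moves the shift from \<open>f\<close> to the character, so the
      difference quotient of \<open>f\<close> becomes a difference quotient of \<open>wave\<close>
      at 0.\<close>
    have 1: "(\<integral>x. f (v + x) * wave (- (x \<bullet> \<xi>)) \<partial>lborel) = wave (v \<bullet> \<xi>) * fourier f \<xi>"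
    proof -
      have "(\<integral>x. f (v + x) * wave (- (x \<bullet> \<xi>)) \<partial>lborel) = (\<integral>x. (\<lambda>y. wave (v \<bullet> \<xi>) * (f y * wave (- (y \<bullet> \<xi>)))) (v + x) \<partial>lborel)"
        by (intro Bochner_Integration.integral_cong refl) (simp add: inner_add_left mult.left_commute[of "wave (v \<bullet> \<xi>)"] flip: wave_add)
      also have "\<dots> = wave (v \<bullet> \<xi>) * fourier f \<xi>"
        by (subst integral_lborel_plus) (auto simp: fourier_def)
      finally show ?thesis .
    qed
    have "(\<integral>x. q n x * wave (- (x \<bullet> \<xi>)) \<partial>lborel) =
       (\<integral>x. (f (v + x) * wave (- (x \<bullet> \<xi>)) - f x * wave (- (x \<bullet> \<xi>))) / of_real t \<partial>lborel)"
      unfolding q_def t_def[symmetric] by (simp add: v_def left_diff_distrib add.commute)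
    also have "\<dots> = (wave (v \<bullet> \<xi>) * fourier f \<xi> - fourier f \<xi>) / of_real t"
      unfolding integral_divide_zero
      by (subst Bochner_Integration.integral_diff)
        (simp_all add: int integrable_lborel_plus 1, simp add: fourier_def)
    finally show ?thesis unfolding t_def[symmetric] by (simp add: v_def left_diff_distrib)
  qed
  moreover have "((\<lambda>t. wave (t * (b \<bullet> \<xi>))) has_vector_derivative 2 * pi * \<i> * (b \<bullet> \<xi>)) (at 0)"
  proof -
    have "((\<lambda>z. exp (2 * pi * \<i> * (b \<bullet> \<xi>) * z)) has_field_derivative 2 * pi * \<i> * (b \<bullet> \<xi>)) (at (of_real 0))"
      by (auto intro!: derivative_eq_intros)
    from has_vector_derivative_real_field[OF this] show ?thesis
      by (simp add: wave_def cis_conv_exp mult_ac)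
  qed
  from tendsto_mult_right[OF has_vector_derivative_quotient_limit[OF this], of "fourier f \<xi>"]
  have "(\<lambda>n. (wave ((1 / Suc n) * (b \<bullet> \<xi>)) - wave (0 * (b \<bullet> \<xi>))) / of_real (1 / Suc n) * fourier f \<xi>) \<longlonglongrightarrow> 2 * pi * \<i> * (b \<bullet> \<xi>) * fourier f \<xi>" .
  ultimately have "fourier D \<xi> = 2 * pi * \<i> * (b \<bullet> \<xi>) * fourier f \<xi>"
    unfolding fourier_def[of D] by (auto intro: LIMSEQ_unique)
  then show ?thesis by (simp add: D_def inner_commute)
qed

lemma fourier_partial_iterated:
  fixes f :: "'a::euclidean_space \<Rightarrow> complex"
  assumes f: "schwartz f" and b: "b \<in> Basis"
  shows "fourier (partials (replicate k b) f) \<xi> = (2 * pi * \<i> * (\<xi> \<bullet> b)) ^ k * fourier f \<xi>"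
proof (induction k)
  case (Suc k)
  have "schwartz (partials (replicate k b) f)" using assms by (intro schwartz_partials) auto
  from fourier_partial[OF this b, of \<xi>] Suc show ?case by (simp add: mult.assoc)
qed simp

text \<open>The \<open>k\<close>-th partial derivative along each axis controls the
  \<open>k\<close>-th power of that coordinate times the transform. The largest coordinate controls
  the norm up to the factor \<open>DIM('a)\<close>.\<close>

lemma rapid_fourier:
  fixes f :: "'a::euclidean_space \<Rightarrow> complex"
  assumes f: "schwartz f"
  shows "rapid (fourier f)"
  unfolding rapid_def
proof
  fix k :: nat
  define I where "I = (\<lambda>b. \<integral>x. norm (partials (replicate k b) f x) \<partial>lborel)"
  have Ib: "\<bar>\<xi> \<bullet> b\<bar> ^ k * norm (fourier f \<xi>) \<le> I b" if "b \<in> Basis" for b \<xi>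
  proof -
    have "norm (fourier (partials (replicate k b) f) \<xi>) \<le> I b" unfolding I_def by (rule norm_fourier_le)
    then have le: "(2 * pi * \<bar>\<xi> \<bullet> b\<bar>) ^ k * norm (fourier f \<xi>) \<le> I b"
      unfolding fourier_partial_iterated[OF f that] by (simp add: norm_mult norm_power)
    have "\<bar>\<xi> \<bullet> b\<bar> ^ k * norm (fourier f \<xi>) \<le> (2 * pi * \<bar>\<xi> \<bullet> b\<bar>) ^ k * norm (fourier f \<xi>)"
    proof (intro mult_right_mono power_mono)
      have "1 * \<bar>\<xi> \<bullet> b\<bar> \<le> (2 * pi) * \<bar>\<xi> \<bullet> b\<bar>" using pi_gt3 by (intro mult_right_mono) auto
      then show "\<bar>\<xi> \<bullet> b\<bar> \<le> 2 * pi * \<bar>\<xi> \<bullet> b\<bar>" by simp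
    qed auto
    with le show ?thesis by linarith
  qed
  have "norm \<xi> ^ k * norm (fourier f \<xi>) \<le> real DIM('a) ^ k * (\<Sum>b\<in>Basis. I b)" for \<xi>
  proof -
    define M where "M = Max ((\<lambda>b. \<bar>\<xi> \<bullet> b\<bar>) ` Basis)"
    have "M \<in> (\<lambda>b. \<bar>\<xi> \<bullet> b\<bar>) ` Basis" unfolding M_def by (intro Max_in) auto
    then obtain b where b: "b \<in> Basis" "M = \<bar>\<xi> \<bullet> b\<bar>" by auto
    have "norm \<xi> \<le> (\<Sum>b\<in>Basis. \<bar>\<xi> \<bullet> b\<bar>)" by (rule norm_le_l1)
    also have "\<dots> \<le> (\<Sum>b\<in>(Basis::'a set). M)" unfolding M_def by (intro sum_mono Max_ge) auto
    finally have "norm \<xi> \<le> real DIM('a) * M" by simp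
    then have "norm \<xi> ^ k * norm (fourier f \<xi>) \<le> (real DIM('a) * M) ^ k * norm (fourier f \<xi>)"
      by (intro mult_right_mono power_mono) auto
    also have "\<dots> \<le> real DIM('a) ^ k * I b"
      using Ib[OF b(1), of \<xi>] by (simp add: power_mult_distrib b(2) mult.assoc mult_left_mono)
    also have "I b \<le> (\<Sum>b\<in>Basis. I b)" using b by (intro member_le_sum) (auto simp: I_def)
    finally show ?thesis by (simp add: mult_left_mono)
  qed
  then show "\<exists>B. \<forall>\<xi>. norm \<xi> ^ k * norm (fourier f \<xi>) \<le> B" by blast
qed

section \<open>Gaussians are Schwartz functions\<close>

text \<open>Polynomial multiples of one Gaussian. The class is closed under directional derivatives
  and (for \<open>0 < t\<close>) its members decay rapidly, so the Schwartz property follows without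
  a formula for iterated derivatives.\<close>

inductive poly_gauss :: "real \<Rightarrow> ('a::euclidean_space \<Rightarrow> complex) \<Rightarrow> bool" for t where
  base: "poly_gauss t (\<lambda>x. of_real (gauss t x))"
| coord: "poly_gauss t f \<Longrightarrow> poly_gauss t (\<lambda>x. of_real (x \<bullet> v) * f x)"
| scale: "poly_gauss t f \<Longrightarrow> poly_gauss t (\<lambda>x. c * f x)"
| add: "poly_gauss t f \<Longrightarrow> poly_gauss t g \<Longrightarrow> poly_gauss t (\<lambda>x. f x + g x)"

lemma poly_gauss_derivative:
  "poly_gauss t f \<Longrightarrow> \<exists>D. (\<forall>x. (f has_derivative D x) (at x)) \<and> (\<forall>v. poly_gauss t (\<lambda>x. D x v))"
proof (induction rule: poly_gauss.induct)
  case base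
  have "((\<lambda>x. complex_of_real (gauss t x)) has_derivative (\<lambda>v. of_real (- 2 * pi * t\<^sup>2) * (of_real (x \<bullet> v) * of_real (gauss t x)))) (at x)" for x :: 'a
    unfolding gauss_def power_mult_distrib power2_norm_eq_inner
    by (auto intro!: derivative_eq_intros simp: inner_commute fun_eq_iff mult_ac)
  moreover have "poly_gauss t (\<lambda>x. of_real (- 2 * pi * t\<^sup>2) * (of_real (x \<bullet> v) * of_real (gauss t x)))" for v :: 'a
    by (intro poly_gauss.intros)
  ultimately show ?case by (intro exI conjI allI)
next
  case (coord f w)
  then obtain D where D: "\<And>x. (f has_derivative D x) (at x)" "\<And>v. poly_gauss t (\<lambda>x. D x v)" by blast
  have "((\<lambda>x. of_real (x \<bullet> w) * f x) has_derivative (\<lambda>v. of_real (x \<bullet> w) * D x v + of_real (v \<bullet> w) * f x)) (at x)" for x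
    by (intro derivative_intros D)
  moreover have "poly_gauss t (\<lambda>x. of_real (x \<bullet> w) * D x v + of_real (v \<bullet> w) * f x)" for v
    by (intro poly_gauss.intros D coord)
  ultimately show ?case by (intro exI conjI allI)
next
  case (scale f c)
  then obtain D where D: "\<And>x. (f has_derivative D x) (at x)" "\<And>v. poly_gauss t (\<lambda>x. D x v)" by blast
  have "((\<lambda>x. c * f x) has_derivative (\<lambda>v. c * D x v)) (at x)" for x
    by (intro derivative_intros D)
  moreover have "poly_gauss t (\<lambda>x. c * D x v)" for v
    by (intro poly_gauss.intros D)
  ultimately show ?case by (intro exI conjI allI)
next
  case (add f g)
  then obtain D E where D: "\<And>x. (f has_derivative D x) (at x)" "\<And>v. poly_gauss t (\<lambda>x. D x v)"
    "\<And>x. (g has_derivative E x) (at x)" "\<And>v. poly_gauss t (\<lambda>x. E x v)" by blast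
  have "((\<lambda>x. f x + g x) has_derivative (\<lambda>v. D x v + E x v)) (at x)" for x
    by (intro derivative_intros D)
  moreover have "poly_gauss t (\<lambda>x. D x v + E x v)" for v
    by (intro poly_gauss.intros D)
  ultimately show ?case by (intro exI conjI allI)
qed

lemma power_le_exp:
  assumes "0 \<le> (u::real)"
  shows "u ^ k \<le> fact k * exp u"
proof -
  have "(\<Sum>n\<in>{k}. u ^ n /\<^sub>R fact n) \<le> exp u"
    unfolding exp_def using assms by (intro sum_le_suminf summable_exp_generic) auto
  then show ?thesis by (simp add: divide_inverse[symmetric] field_simps)
qed

lemma rapid_poly_gauss:
  assumes t: "0 < t"
  shows "poly_gauss t f \<Longrightarrow> rapid f"
proof (induction rule: poly_gauss.induct)
  case base
  show ?case unfolding rapid_def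
  proof
    fix k :: nat
    have "norm x ^ k * norm (complex_of_real (gauss t x)) \<le> 1 + fact k / (pi * t\<^sup>2) ^ k" for x :: 'a
    proof -
      define u where "u = pi * (t * norm x)\<^sup>2"
      \<comment> \<open>The exponent is made even because \<open>u\<close> contains the square of
        the norm.\<close>
      have "norm x ^ k \<le> 1 + norm x ^ (2 * k)"
      proof (cases "norm x \<le> 1")
        case False
        then have "norm x ^ k \<le> norm x ^ (2 * k)" by (intro power_increasing) auto
        then show ?thesis by simp
      qed (auto simp: power_le_one intro: add_increasing2)
      also have "norm x ^ (2 * k) = u ^ k / (pi * t\<^sup>2) ^ k"
        using t by (simp add: u_def power_mult_distrib power_mult power_divide)
      also have "\<dots> \<le> fact k * exp u / (pi * t\<^sup>2) ^ k"
        by (intro divide_right_mono power_le_exp) (auto simp: u_def)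
      finally have "norm x ^ k * exp (- u) \<le> (1 + fact k * exp u / (pi * t\<^sup>2) ^ k) * exp (- u)"
        by (rule mult_right_mono) auto
      also have "\<dots> = exp (- u) + fact k / (pi * t\<^sup>2) ^ k * (exp u * exp (- u))"
        by (simp add: algebra_simps)
      also have "\<dots> \<le> 1 + fact k / (pi * t\<^sup>2) ^ k"
        by (simp add: u_def flip: exp_add)
      finally show ?thesis by (simp add: gauss_def u_def)
    qed
    then show "\<exists>B. \<forall>x::'a. norm x ^ k * norm (complex_of_real (gauss t x)) \<le> B" by blast
  qed
next
  case (coord f v)
  show ?case unfolding rapid_def
  proof
    fix k :: nat
    obtain B where B: "\<And>x. norm x ^ Suc k * norm (f x) \<le> B" using coord.IH unfolding rapid_def by blast
    have "norm x ^ k * norm (of_real (x \<bullet> v) * f x) \<le> norm v * B" for x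
    proof -
      have "norm x ^ k * norm (of_real (x \<bullet> v) * f x) \<le> norm x ^ k * ((norm x * norm v) * norm (f x))"
        unfolding norm_mult norm_of_real by (intro mult_left_mono mult_right_mono Cauchy_Schwarz_ineq2) auto
      also have "\<dots> = norm v * (norm x ^ Suc k * norm (f x))" by simp
      also have "\<dots> \<le> norm v * B" by (intro mult_left_mono B) auto
      finally show ?thesis .
    qed
    then show "\<exists>B. \<forall>x. norm x ^ k * norm (of_real (x \<bullet> v) * f x) \<le> B" by blast
  qed
next
  case (scale f c)
  show ?case unfolding rapid_def
  proof
    fix k :: nat
    obtain B where B: "\<And>x. norm x ^ k * norm (f x) \<le> B" using scale.IH unfolding rapid_def by blast
    have "norm x ^ k * norm (c * f x) \<le> norm c * B" for x
      using mult_left_mono[OF B[of x], of "norm c"] by (simp add: norm_mult mult_ac)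
    then show "\<exists>B. \<forall>x. norm x ^ k * norm (c * f x) \<le> B" by blast
  qed
next
  case (add f g)
  show ?case unfolding rapid_def
  proof
    fix k :: nat
    obtain B C where B: "\<And>x. norm x ^ k * norm (f x) \<le> B" "\<And>x. norm x ^ k * norm (g x) \<le> C"
      using add.IH unfolding rapid_def by metis
    have "norm x ^ k * norm (f x + g x) \<le> B + C" for x
    proof -
      have "norm x ^ k * norm (f x + g x) \<le> norm x ^ k * (norm (f x) + norm (g x))"
        by (intro mult_left_mono norm_triangle_ineq) auto
      then show ?thesis using B(1)[of x] B(2)[of x] by (simp add: distrib_left)
    qed
    then show "\<exists>B. \<forall>x. norm x ^ k * norm (f x + g x) \<le> B" by blast
  qed
qed

lemma poly_gauss_partials: "poly_gauss t f \<Longrightarrow> poly_gauss t (partials bs f)"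
proof (induction bs)
  case (Cons b bs)
  then obtain D where D: "\<And>x. (partials bs f has_derivative D x) (at x)" "poly_gauss t (\<lambda>x. D x b)"
    using poly_gauss_derivative by blast
  have "partials (b # bs) f = (\<lambda>x. D x b)"
    using frechet_derivative_at[OF D(1)] by (simp add: fun_eq_iff)
  with D(2) show ?case by simp
qed simp

lemma schwartz_gauss:
  assumes "0 < t"
  shows "schwartz (\<lambda>x::'a::euclidean_space. of_real (gauss t x))"
  unfolding schwartz_def
proof (intro allI impI)
  fix bs :: "'a list"
  have *: "poly_gauss t (partials bs (\<lambda>x. of_real (gauss t x)))"
    by (intro poly_gauss_partials base)
  from poly_gauss_derivative[OF *] rapid_poly_gauss[OF assms *]
  show "(\<forall>x. partials bs (\<lambda>x. of_real (gauss t x)) differentiable at x) \<and>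
        (\<forall>k::nat. \<exists>B. \<forall>x. norm x ^ k * norm (partials bs (\<lambda>x. of_real (gauss t x)) x) \<le> B)"
    unfolding rapid_def differentiable_def by blast
qed

section \<open>Mixed Lebesgue norms\<close>

lemma epowr_ennreal: "0 \<le> x \<Longrightarrow> epowr (ennreal x) r = ennreal (x powr r)"
  by (simp add: epowr_def)

lemma epowr_mono:
  assumes "a \<le> b" "0 \<le> r"
  shows "epowr a r \<le> epowr b r"
proof (cases "b = \<infinity>")
  case False
  then have "a < \<infinity>" "b < \<infinity>" using assms by (auto simp: less_top top_unique)
  then show ?thesis using assms
    by (auto simp: epowr_def less_top intro!: ennreal_leI powr_mono2 enn2real_mono)
qed (simp add: epowr_def)

lemma measurable_epowr [measurable]: "(\<lambda>x. epowr x r) \<in> borel_measurable borel"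
  unfolding epowr_def by measurable

lemma ennreal_exponent_cases:
  assumes "1 \<le> (p::ennreal)"
  obtains (top) "p = \<infinity>" | (real) P where "p = ennreal P" "1 \<le> P"
proof (cases p)
  case (real P)
  with assms have "1 \<le> P" by (metis ennreal_1 ennreal_le_iff)
  with real that(2) show ?thesis by blast
qed (use that in auto)

text \<open>Expresses superlevel sets of the essential supremum through measures of sections. These
  depend measurably on a parameter, which yields \<open>measurable_Lp_norm\<close> for the infinite
  exponent.\<close>

lemma less_esssup_iff:
  assumes [measurable]: "h \<in> borel_measurable M"
  shows "y < esssup M h \<longleftrightarrow> 0 < emeasure M {x \<in> space M. y < h x}"
proof
  assume "0 < emeasure M {x \<in> space M. y < h x}"
  show "y < esssup M h"
  proof (rule ccontr)
    assume "\<not> y < esssup M h"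
    then have "AE x in M. \<not> y < h x" using esssup_AE[where f=h and M=M] by (auto simp: not_less elim: eventually_mono)
    then have "emeasure M {x \<in> space M. y < h x} = 0" by (subst (asm) AE_iff_measurable) auto
    then show False using \<open>0 < emeasure M _\<close> by simp
  qed
qed (rule esssup_pos_measure[OF assms])

lemma measurable_Lp_norm:
  fixes f :: "'a::euclidean_space \<Rightarrow> 'b::euclidean_space \<Rightarrow> ennreal"
  assumes [measurable]: "case_prod f \<in> borel_measurable (borel \<Otimes>\<^sub>M borel)"
  shows "(\<lambda>x. Lp_norm p (f x)) \<in> borel_measurable borel"
proof (cases "p = \<infinity>")
  case True
  have "{x \<in> space borel. y < esssup lborel (f x)} \<in> sets borel" for y
  proof -
    have "{x \<in> space borel. y < esssup lborel (f x)} = {x \<in> space borel. 0 < emeasure lborel {z \<in> space lborel. y < f x z}}"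
      by (intro Collect_cong conj_cong refl less_esssup_iff) measurable
    also have "\<dots> \<in> sets borel" by measurable
    finally show ?thesis .
  qed
  then show ?thesis unfolding Lp_norm_def using True by (simp add: borel_measurableI_greater)
next
  case False
  then show ?thesis unfolding Lp_norm_def by simp
qed

text \<open>Interpolation between the supremum \<open>M\<close> and the integral \<open>I\<close> of
  a majorant: \<open>w^P\<close> is at most \<open>M^(P-1) * w\<close>. For
  \<open>p = \<infinity>\<close> the exponent \<open>1 / enn2real p\<close> is 0 and only
  \<open>M\<close> remains.\<close>

lemma Lp_norm_le:
  fixes h :: "'a::euclidean_space \<Rightarrow> ennreal"
  assumes [measurable]: "h \<in> borel_measurable borel"
    and h: "\<And>x. h x \<le> ennreal (w x)" and w: "\<And>x. 0 \<le> w x" "\<And>x. w x \<le> M"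
    and [measurable]: "w \<in> borel_measurable borel"
    and I: "(\<integral>\<^sup>+x. ennreal (w x) \<partial>lborel) \<le> ennreal I" and pos: "0 < M" "0 < I" and p: "1 \<le> p"
  shows "Lp_norm p h \<le> ennreal (M powr (1 - 1 / enn2real p) * I powr (1 / enn2real p))"
  using p
proof (cases rule: ennreal_exponent_cases)
  case top
  have "h x \<le> ennreal M" for x using h[of x] w(2)[of x] by (meson ennreal_leI order_trans)
  then have "esssup lborel h \<le> ennreal M" by (intro esssup_I) auto
  then show ?thesis using top pos by (simp add: Lp_norm_def)
next
  case (real P)
  have "(\<integral>\<^sup>+x. epowr (h x) P \<partial>lborel) \<le> (\<integral>\<^sup>+x. ennreal (M powr (P - 1)) * ennreal (w x) \<partial>lborel)"
  proof (intro nn_integral_mono)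
    fix x
    have "epowr (h x) P \<le> epowr (ennreal (w x)) P" using real by (intro epowr_mono h) auto
    also have "\<dots> = ennreal (w x powr (P - 1) * w x)"
      using w(1)[of x] epowr_ennreal[of "w x" P] by (cases "w x = 0") (auto simp: powr_diff)
    also have "\<dots> \<le> ennreal (M powr (P - 1) * w x)"
      using w[of x] real by (intro ennreal_leI mult_right_mono powr_mono2) auto
    finally show "epowr (h x) P \<le> ennreal (M powr (P - 1)) * ennreal (w x)"
      by (simp add: ennreal_mult w)
  qed
  also have "\<dots> \<le> ennreal (M powr (P - 1)) * ennreal I"
    by (simp add: nn_integral_cmult mult_left_mono I)
  also have "\<dots> = ennreal (M powr (P - 1) * I)" using pos by (simp add: ennreal_mult)
  finally have "Lp_norm p h \<le> epowr (ennreal (M powr (P - 1) * I)) (1 / P)"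
    using real unfolding Lp_norm_def by (auto intro!: epowr_mono)
  also have "\<dots> = ennreal (M powr ((P - 1) * (1 / P)) * I powr (1 / P))"
    using pos by (simp add: epowr_ennreal powr_mult powr_powr)
  also have "(P - 1) * (1 / P) = 1 - 1 / P" using real by (simp add: field_simps)
  finally show ?thesis using real by simp
qed

text \<open>Hoelder's inequality up to the factor 2. It comes from integrating the pointwise bound
  \<open>h w \<le> t\<^bsup>1-P\<^esup> M h\<^bsup>P\<^esup> + t w\<close> and choosing \<open>t\<close> such that both terms have the same integral.\<close>

lemma nn_integral_le_Lp_norm:
  fixes h :: "'a::euclidean_space \<Rightarrow> ennreal"
  assumes [measurable]: "h \<in> borel_measurable borel"
    and w: "\<And>x. 0 \<le> w x" "\<And>x. w x \<le> M"
    and [measurable]: "w \<in> borel_measurable borel"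
    and I: "(\<integral>\<^sup>+x. ennreal (w x) \<partial>lborel) \<le> ennreal I" and pos: "0 < M" "0 < I" and p: "1 \<le> p"
  shows "(\<integral>\<^sup>+x. h x * ennreal (w x) \<partial>lborel)
    \<le> ennreal (2 * (M powr (1 / enn2real p) * I powr (1 - 1 / enn2real p))) * Lp_norm p h"
  using p
proof (cases rule: ennreal_exponent_cases)
  case top
  have "(\<integral>\<^sup>+x. h x * ennreal (w x) \<partial>lborel) \<le> (\<integral>\<^sup>+x. esssup lborel h * ennreal (w x) \<partial>lborel)"
    using esssup_AE[where f=h and M=lborel] by (intro nn_integral_mono_AE) (auto elim!: eventually_mono intro: mult_right_mono)
  also have "\<dots> \<le> esssup lborel h * ennreal I" by (simp add: nn_integral_cmult mult_left_mono I)
  also have "\<dots> \<le> esssup lborel h * ennreal (2 * I)"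
    using pos by (intro mult_left_mono ennreal_leI) auto
  finally show ?thesis using top pos by (simp add: Lp_norm_def mult.commute)
next
  case (real P)
  define H where "H = (\<integral>\<^sup>+x. epowr (h x) P \<partial>lborel)"
  have Lp: "Lp_norm p h = epowr H (1 / P)" using real by (simp add: Lp_norm_def H_def)
  show ?thesis
  \<comment> \<open>These values are set apart because the level \<open>t\<close> chosen below must
    be positive and finite.\<close>
  proof (cases "H = 0 \<or> H = \<infinity>")
    case True
    then show ?thesis
    proof
      assume "H = \<infinity>"
      then show ?thesis using pos unfolding Lp by (simp add: epowr_def ennreal_mult_top)
    next
      assume "H = 0"
      then have "AE x in lborel. epowr (h x) P = 0" unfolding H_def by (simp add: nn_integral_0_iff_AE)
      then have "AE x in lborel. h x = 0"
        by eventually_elim (auto simp: epowr_def enn2real_eq_0_iff split: if_splits)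
      then have "AE x in lborel. h x * ennreal (w x) = 0" by eventually_elim auto
      then have "(\<integral>\<^sup>+x. h x * ennreal (w x) \<partial>lborel) = 0" by (subst nn_integral_0_iff_AE) auto
      then show ?thesis by simp
    qed
  next
    case False
    then obtain H' where H': "H = ennreal H'" "0 < H'"
      by (cases H) (auto simp: less_le)
    define t where "t = (M * H' / I) powr (1 / P)"
    have t: "0 < t" using pos H' by (simp add: t_def)
    have tP: "t powr P = M * H' / I" using pos H' real by (simp add: t_def powr_powr)
    have pw: "h x * ennreal (w x) \<le> ennreal (t powr (1 - P) * M) * epowr (h x) P + ennreal t * ennreal (w x)" for x
    proof (cases "h x")
      case (real a)
      \<comment> \<open>Up to the level \<open>t\<close> the second term suffices. Above it, write
        \<open>a\<close> as \<open>a^P * a^(1-P)\<close>; the exponent \<open>1 - P\<close> is at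
        most 0, so replacing \<open>a\<close> by \<open>t\<close> there increases the
        product.\<close>
      have "a * w x \<le> t powr (1 - P) * M * a powr P + t * w x"
      proof (cases "a \<le> t")
        case True
        then have "a * w x \<le> t * w x" by (intro mult_right_mono w)
        moreover have "0 \<le> t powr (1 - P) * M * a powr P" using pos by simp
        ultimately show ?thesis by linarith
      next
        case False
        have "a powr (1 - P) \<le> t powr (1 - P)" using False t \<open>1 \<le> P\<close> by (intro powr_mono2') auto
        then have "a powr P * a powr (1 - P) \<le> a powr P * t powr (1 - P)" by (intro mult_left_mono) auto
        moreover have "a powr P * a powr (1 - P) = a" using False t by (simp flip: powr_add)
        ultimately have "a \<le> a powr P * t powr (1 - P)" by simp
        then have "a * w x \<le> (a powr P * t powr (1 - P)) * M" using w[of x] real by (intro mult_mono) auto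
        moreover have "0 \<le> t * w x" using t w by simp
        ultimately show ?thesis by (simp add: mult_ac)
      qed
      then have "ennreal (a * w x) \<le> ennreal (t powr (1 - P) * M * a powr P + t * w x)" by (rule ennreal_leI)
      then show ?thesis using real pos w t by (simp add: epowr_ennreal ennreal_mult ennreal_plus)
    next
      case top
      then show ?thesis using t pos by (simp add: epowr_def ennreal_mult_top)
    qed
    have "(\<integral>\<^sup>+x. h x * ennreal (w x) \<partial>lborel) \<le>
        (\<integral>\<^sup>+x. ennreal (t powr (1 - P) * M) * epowr (h x) P + ennreal t * ennreal (w x) \<partial>lborel)"
      by (intro nn_integral_mono pw)
    also have "\<dots> = ennreal (t powr (1 - P) * M) * H + ennreal t * (\<integral>\<^sup>+x. ennreal (w x) \<partial>lborel)"
      by (simp add: nn_integral_add nn_integral_cmult H_def)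
    also have "\<dots> \<le> ennreal (t powr (1 - P) * M) * H + ennreal t * ennreal I"
      by (intro add_left_mono mult_left_mono I) auto
    also have "\<dots> = ennreal (t powr (1 - P) * M * H' + t * I)"
      using H' t pos by (simp add: ennreal_mult ennreal_plus)
    also have "t powr (1 - P) * M * H' = t * I"
      using t pos H' by (simp add: powr_diff tP)
    also have "t * I + t * I = 2 * (M powr (1 / P) * I powr (1 - 1 / P)) * H' powr (1 / P)"
      using pos H' by (simp add: t_def powr_mult powr_divide powr_diff)
    also have "ennreal \<dots> = ennreal (2 * (M powr (1 / P) * I powr (1 - 1 / P))) * epowr H (1 / P)"
      using H' by (simp add: epowr_ennreal ennreal_mult)
    finally show ?thesis using real Lp by simp
  qed
qed

text \<open>The interpolated bound is homogeneous of degree one, so a factor that is constant in the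
  inner variable passes through it.\<close>

lemma powr_scale_interpolate:
  fixes B M I r :: real
  assumes "0 < B" "0 < M" "0 < I"
  shows "(M * B) powr (1 - r) * (I * B) powr r = M powr (1 - r) * I powr r * B"
  using assms by (simp add: powr_mult powr_diff)

text \<open>A majorant in product form allows \<open>Lp_norm_le\<close> twice: in \<open>x\<close>
  with \<open>B2 y\<close> as a constant, then in \<open>y\<close>.\<close>

lemma mixed_norm_le:
  fixes V :: "'a::euclidean_space \<Rightarrow> 'b::euclidean_space \<Rightarrow> complex"
  assumes V[measurable]: "(\<lambda>(y, x). V x y) \<in> borel_measurable (borel \<Otimes>\<^sub>M borel)"
    and bound: "\<And>x y. norm (V x y) \<le> B1 x * B2 y"
    and B1: "\<And>x. 0 < B1 x" "\<And>x. B1 x \<le> M1" "(\<integral>\<^sup>+x. ennreal (B1 x) \<partial>lborel) \<le> ennreal I1" "0 < I1"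
    and B2: "\<And>x. 0 < B2 x" "\<And>x. B2 x \<le> M2" "(\<integral>\<^sup>+x. ennreal (B2 x) \<partial>lborel) \<le> ennreal I2" "0 < I2"
    and [measurable]: "B1 \<in> borel_measurable borel" "B2 \<in> borel_measurable borel"
    and p: "1 \<le> p" and q: "1 \<le> q"
  shows "Lp_norm q (\<lambda>y. Lp_norm p (\<lambda>x. ennreal (norm (V x y))))
    \<le> ennreal (M1 powr (1 - 1 / enn2real p) * I1 powr (1 / enn2real p)
      * (M2 powr (1 - 1 / enn2real q) * I2 powr (1 / enn2real q)))"
proof -
  have M: "0 < M1" "0 < M2" using B1(1,2) B2(1,2) by (meson less_le_trans)+
  define c where "c = M1 powr (1 - 1 / enn2real p) * I1 powr (1 / enn2real p)"
  have c: "0 < c" using M B1(4) by (simp add: c_def)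
  have [measurable]: "(\<lambda>x. V x y) \<in> borel_measurable borel" for y
    using measurable_Pair2[OF V, of y] by simp
  have inner: "Lp_norm p (\<lambda>x. ennreal (norm (V x y))) \<le> ennreal (c * B2 y)" for y
  proof -
    have "(\<integral>\<^sup>+x. ennreal (B1 x * B2 y) \<partial>lborel) = (\<integral>\<^sup>+x. ennreal (B1 x) \<partial>lborel) * ennreal (B2 y)"
      using less_imp_le[OF B1(1)] less_imp_le[OF B2(1)] by (simp add: ennreal_mult nn_integral_multc)
    also have "\<dots> \<le> ennreal I1 * ennreal (B2 y)" by (intro mult_right_mono B1) auto
    also have "\<dots> = ennreal (I1 * B2 y)" using less_imp_le[OF B2(1)] B1(4) by (simp add: ennreal_mult)
    finally have "Lp_norm p (\<lambda>x. ennreal (norm (V x y))) \<le>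
       ennreal ((M1 * B2 y) powr (1 - 1 / enn2real p) * (I1 * B2 y) powr (1 / enn2real p))"
      using M B1 B2 bound p less_imp_le[OF B1(1)] less_imp_le[OF B2(1)]
      by (intro Lp_norm_le[where w="\<lambda>x. B1 x * B2 y"] ennreal_leI mult_right_mono mult_nonneg_nonneg mult_pos_pos) auto
    then show ?thesis using powr_scale_interpolate[of "B2 y" M1 I1 "1 / enn2real p"] B1 B2 M
      by (simp add: c_def)
  qed
  have "(\<integral>\<^sup>+y. ennreal (c * B2 y) \<partial>lborel) = ennreal c * (\<integral>\<^sup>+y. ennreal (B2 y) \<partial>lborel)"
    using less_imp_le[OF B2(1)] c by (simp add: ennreal_mult nn_integral_cmult)
  also have "\<dots> \<le> ennreal c * ennreal I2" by (intro mult_left_mono B2) auto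
  also have "\<dots> = ennreal (I2 * c)" using c B2(4) by (simp add: ennreal_mult mult.commute)
  finally have "Lp_norm q (\<lambda>y. Lp_norm p (\<lambda>x. ennreal (norm (V x y)))) \<le>
     ennreal ((M2 * c) powr (1 - 1 / enn2real q) * (I2 * c) powr (1 / enn2real q))"
    using c M B2 q less_imp_le[OF B2(1)]
    by (intro Lp_norm_le[where w="\<lambda>y. c * B2 y"] inner measurable_Lp_norm) (auto simp: mult.commute[of _ c])
  then show ?thesis using powr_scale_interpolate[of c M2 I2 "1 / enn2real q"] c M B2
    by (simp add: c_def mult_ac)
qed

text \<open>The dual of \<open>mixed_norm_le\<close>: the weights enter with the conjugate exponents
  \<open>1 - 1/p\<close> and \<open>1 - 1/q\<close>, and the constant 4 comes from two uses of the
  Hoelder bound with factor 2.\<close>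

lemma nn_integral_le_mixed_norm:
  fixes V :: "'a::euclidean_space \<Rightarrow> 'b::euclidean_space \<Rightarrow> complex"
  assumes V[measurable]: "(\<lambda>(y, x). V x y) \<in> borel_measurable (borel \<Otimes>\<^sub>M borel)"
    and B1: "\<And>x. 0 < B1 x" "\<And>x. B1 x \<le> M1" "(\<integral>\<^sup>+x. ennreal (B1 x) \<partial>lborel) \<le> ennreal I1" "0 < I1"
    and B2: "\<And>x. 0 < B2 x" "\<And>x. B2 x \<le> M2" "(\<integral>\<^sup>+x. ennreal (B2 x) \<partial>lborel) \<le> ennreal I2" "0 < I2"
    and [measurable]: "B1 \<in> borel_measurable borel" "B2 \<in> borel_measurable borel"
    and p: "1 \<le> p" and q: "1 \<le> q"
  shows "(\<integral>\<^sup>+y. (\<integral>\<^sup>+x. ennreal (norm (V x y)) * ennreal (B1 x) \<partial>lborel) * ennreal (B2 y) \<partial>lborel)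
    \<le> ennreal (4 * (M1 powr (1 / enn2real p) * I1 powr (1 - 1 / enn2real p)
      * (M2 powr (1 / enn2real q) * I2 powr (1 - 1 / enn2real q))))
      * Lp_norm q (\<lambda>y. Lp_norm p (\<lambda>x. ennreal (norm (V x y))))"
proof -
  have M: "0 < M1" "0 < M2" using B1(1,2) B2(1,2) by (meson less_le_trans)+
  define c1 where "c1 = 2 * (M1 powr (1 / enn2real p) * I1 powr (1 - 1 / enn2real p))"
  define c2 where "c2 = 2 * (M2 powr (1 / enn2real q) * I2 powr (1 - 1 / enn2real q))"
  have c: "0 \<le> c1" "0 \<le> c2" by (simp_all add: c1_def c2_def)
  define L where "L = (\<lambda>y. Lp_norm p (\<lambda>x. ennreal (norm (V x y))))"
  have [measurable]: "(\<lambda>x. V x y) \<in> borel_measurable borel" for y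
    using measurable_Pair2[OF V, of y] by simp
  have [measurable]: "L \<in> borel_measurable borel" unfolding L_def by (intro measurable_Lp_norm) simp
  have "(\<integral>\<^sup>+x. ennreal (norm (V x y)) * ennreal (B1 x) \<partial>lborel) \<le> ennreal c1 * L y" for y
    unfolding c1_def L_def using B1 M p less_imp_le[OF B1(1)] by (intro nn_integral_le_Lp_norm) auto
  then have "(\<integral>\<^sup>+y. (\<integral>\<^sup>+x. ennreal (norm (V x y)) * ennreal (B1 x) \<partial>lborel) * ennreal (B2 y) \<partial>lborel)
    \<le> (\<integral>\<^sup>+y. ennreal c1 * (L y * ennreal (B2 y)) \<partial>lborel)"
    by (intro nn_integral_mono) (simp add: mult_right_mono flip: mult.assoc)
  also have "\<dots> = ennreal c1 * (\<integral>\<^sup>+y. L y * ennreal (B2 y) \<partial>lborel)" by (simp add: nn_integral_cmult)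
  also have "\<dots> \<le> ennreal c1 * (ennreal c2 * Lp_norm q L)"
    unfolding c2_def using B2 M q less_imp_le[OF B2(1)] by (intro mult_left_mono nn_integral_le_Lp_norm) auto
  also have "\<dots> = ennreal (c1 * c2) * Lp_norm q L" using c by (simp add: ennreal_mult mult.assoc)
  also have "c1 * c2 = 4 * (M1 powr (1 / enn2real p) * I1 powr (1 - 1 / enn2real p)
      * (M2 powr (1 / enn2real q) * I2 powr (1 - 1 / enn2real q)))"
    by (simp add: c1_def c2_def)
  finally show ?thesis by (simp only: L_def)
qed

section \<open>The short-time Fourier transform\<close>

lemma measurable_cnj [measurable]: "cnj \<in> borel_measurable borel"
  by (intro borel_measurable_continuous_onI continuous_intros)

text \<open>Valid for every \<open>f\<close>, since the Bochner integral of a non-integrable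
  function is 0.\<close>

lemma norm_integral_le_nn_integral:
  fixes f :: "'a \<Rightarrow> complex"
  shows "ennreal (norm (integral\<^sup>L M f)) \<le> (\<integral>\<^sup>+x. ennreal (norm (f x)) \<partial>M)"
  by (cases "integrable M f") (auto simp: integral_norm_bound_ennreal not_integrable_integral_eq)

lemma integrable_pair_mult:
  fixes f g :: "'a::euclidean_space \<Rightarrow> complex"
  assumes "integrable lborel f" "integrable lborel g"
    and [measurable]: "k \<in> borel_measurable (borel \<Otimes>\<^sub>M borel)"
    and bound: "\<And>x y. norm (k (x, y)) \<le> norm (f x) * norm (g y)"
  shows "integrable (lborel \<Otimes>\<^sub>M lborel) (k :: 'a \<times> 'a \<Rightarrow> complex)"
proof -
  have [measurable]: "f \<in> borel_measurable borel" "g \<in> borel_measurable borel" using assms(1,2) by auto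
  have "integrable (lborel \<Otimes>\<^sub>M lborel) (\<lambda>(x, y). f x * g y)"
    by (rule lborel_pair.Fubini_integrable) (use assms(1,2) in \<open>auto simp: norm_mult\<close>)
  then show ?thesis
    by (rule Bochner_Integration.integrable_bound) (auto simp: norm_mult bound)
qed

text \<open>Reflection and translation make the inner integral of \<open>norm (g (x - y))\<close>
  independent of \<open>x\<close>, so Fubini reduces the claim to integrability of
  \<open>f\<close>.\<close>

lemma integrable_pair_convolution:
  fixes f g :: "'a::euclidean_space \<Rightarrow> complex"
  assumes "integrable lborel f" "integrable lborel g"
    and [measurable]: "k \<in> borel_measurable (borel \<Otimes>\<^sub>M borel)"
    and bound: "\<And>x y. norm (k (x, y)) \<le> norm (f x) * norm (g (x - y))"
  shows "integrable (lborel \<Otimes>\<^sub>M lborel) (k :: 'a \<times> 'a \<Rightarrow> complex)"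
proof -
  have [measurable]: "f \<in> borel_measurable borel" "g \<in> borel_measurable borel" using assms(1,2) by auto
  have I: "(\<integral>y. norm (g (x - y)) \<partial>lborel) = (\<integral>y. norm (g y) \<partial>lborel)" for x
  proof -
    have "(\<integral>y. norm (g (x - y)) \<partial>lborel) = Re (\<integral>y. complex_of_real (norm (g (x - y))) \<partial>lborel)"
      by simp
    also have "(\<integral>y. complex_of_real (norm (g (x - y))) \<partial>lborel) = (\<integral>y. complex_of_real (norm (g y)) \<partial>lborel)"
      by (rule integral_lborel_minus[of "\<lambda>y. complex_of_real (norm (g y))"]) simp
    finally show ?thesis by simp
  qed
  have "integrable (lborel \<Otimes>\<^sub>M lborel) (\<lambda>(x, y). f x * g (x - y))"
  proof (rule lborel_pair.Fubini_integrable)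
    show "AE x in lborel. integrable lborel (\<lambda>y. case (x, y) of (x, y) \<Rightarrow> f x * g (x - y))"
      using integrable_lborel_minus[OF assms(2)] by auto
  qed (use assms(1) in \<open>auto simp: norm_mult I\<close>)
  then show ?thesis
    by (rule Bochner_Integration.integrable_bound) (auto simp: norm_mult bound)
qed

definition inv_fourier :: "('a::euclidean_space \<Rightarrow> complex) \<Rightarrow> 'a \<Rightarrow> complex" where
  "inv_fourier m y = (\<integral>\<eta>. m \<eta> * wave (y \<bullet> \<eta>) \<partial>lborel)"

lemma inv_fourier_eq_fourier: "inv_fourier m y = fourier m (- y)"
  by (simp add: inv_fourier_def fourier_def inner_commute)

lemma measurable_inv_fourier [measurable]:
  fixes m :: "'a::euclidean_space \<Rightarrow> complex"
  assumes [measurable]: "m \<in> borel_measurable borel"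
  shows "inv_fourier m \<in> borel_measurable borel"
  unfolding inv_fourier_def by measurable

lemma stft_regular:
  "stft g (regular_distr F) z \<zeta> = (\<integral>y. F y * (cnj (g (y - z)) * wave (- (y \<bullet> \<zeta>))) \<partial>lborel)"
  unfolding stft_def regular_distr_def exp_eq_wave ..

lemma measurable_stft:
  fixes F g :: "'a::euclidean_space \<Rightarrow> complex"
  assumes [measurable]: "F \<in> borel_measurable borel" "g \<in> borel_measurable borel"
  shows "(\<lambda>(\<zeta>, z). stft g (regular_distr F) z \<zeta>) \<in> borel_measurable (borel \<Otimes>\<^sub>M borel)"
  unfolding stft_regular by measurable

text \<open>Fubini moves the short-time transform to the frequency side. Only \<open>m\<close> has
  to be integrable, which suits the Born--Jordan distribution, whose Fourier transform is explicit
  while the function itself is not.\<close>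

lemma stft_inv_fourier:
  fixes g m :: "'a::euclidean_space \<Rightarrow> complex"
  assumes g: "integrable lborel g" and m: "integrable lborel m"
  shows "stft g (regular_distr (inv_fourier m)) z \<zeta> =
    (\<integral>\<eta>. m \<eta> * (wave (z \<bullet> (\<eta> - \<zeta>)) * cnj (fourier g (\<eta> - \<zeta>))) \<partial>lborel)"
proof -
  have [measurable]: "g \<in> borel_measurable borel" "m \<in> borel_measurable borel" using g m by auto
  have gz: "integrable lborel (\<lambda>y. g (y - z))"
    using integrable_lborel_plus[OF g, of "- z"] by simp
  have "stft g (regular_distr (inv_fourier m)) z \<zeta> =
      (\<integral>y. (\<integral>\<eta>. m \<eta> * cnj (g (y - z)) * wave (y \<bullet> (\<eta> - \<zeta>)) \<partial>lborel) \<partial>lborel)"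
    unfolding stft_regular inv_fourier_def integral_mult_left_zero[symmetric]
    by (intro Bochner_Integration.integral_cong refl)
      (simp add: inner_diff_right wave_diff mult_ac)
  also have "\<dots> = (\<integral>\<eta>. (\<integral>y. m \<eta> * cnj (g (y - z)) * wave (y \<bullet> (\<eta> - \<zeta>)) \<partial>lborel) \<partial>lborel)"
    by (rule lborel_pair.Fubini_integral, rule integrable_pair_mult[OF m gz]) (auto simp: norm_mult)
  also have "\<dots> = (\<integral>\<eta>. m \<eta> * (wave (z \<bullet> (\<eta> - \<zeta>)) * cnj (fourier g (\<eta> - \<zeta>))) \<partial>lborel)"
  proof (intro Bochner_Integration.integral_cong refl)
    fix \<eta>
    have "(\<integral>y. cnj (g (y - z)) * wave (y \<bullet> (\<eta> - \<zeta>)) \<partial>lborel) =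
        (\<integral>y. (\<lambda>u. cnj (g u) * wave ((u + z) \<bullet> (\<eta> - \<zeta>))) (- z + y) \<partial>lborel)"
      by simp
    also have "\<dots> = (\<integral>u. cnj (g u) * wave ((u + z) \<bullet> (\<eta> - \<zeta>)) \<partial>lborel)"
      by (rule integral_lborel_plus) simp
    also have "\<dots> = (\<integral>u. wave (z \<bullet> (\<eta> - \<zeta>)) * cnj (g u * wave (- (u \<bullet> (\<eta> - \<zeta>)))) \<partial>lborel)"
      by (simp add: inner_add_left wave_add mult_ac)
    also have "\<dots> = wave (z \<bullet> (\<eta> - \<zeta>)) * cnj (fourier g (\<eta> - \<zeta>))"
      by (simp add: fourier_def del: complex_cnj_mult)
    finally show "(\<integral>y. m \<eta> * cnj (g (y - z)) * wave (y \<bullet> (\<eta> - \<zeta>)) \<partial>lborel) =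
        m \<eta> * (wave (z \<bullet> (\<eta> - \<zeta>)) * cnj (fourier g (\<eta> - \<zeta>)))"
      by (simp add: mult.assoc)
  qed
  finally show ?thesis .
qed

text \<open>Integrating over the position first separates the window from \<phi>. This evaluates the
  inner integral of the orthogonality relation.\<close>

lemma integral_wave_cnj_stft:
  fixes g \<phi> :: "'a::euclidean_space \<Rightarrow> complex"
  assumes g: "integrable lborel g" and \<phi>: "integrable lborel \<phi>"
  shows "(\<integral>z. wave (z \<bullet> (\<eta> - \<zeta>)) * cnj (stft g (regular_distr \<phi>) z \<zeta>) \<partial>lborel)
    = fourier g (\<eta> - \<zeta>) * cnj (fourier \<phi> \<eta>)"
proof -
  have [measurable]: "g \<in> borel_measurable borel" "\<phi> \<in> borel_measurable borel" using g \<phi> by auto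
  have "(\<integral>z. wave (z \<bullet> (\<eta> - \<zeta>)) * cnj (stft g (regular_distr \<phi>) z \<zeta>) \<partial>lborel) =
     (\<integral>z. (\<integral>y. cnj (\<phi> y) * g (y - z) * (wave (y \<bullet> \<zeta>) * wave (z \<bullet> (\<eta> - \<zeta>))) \<partial>lborel) \<partial>lborel)"
  proof (intro Bochner_Integration.integral_cong refl)
    fix z
    have "cnj (stft g (regular_distr \<phi>) z \<zeta>) = (\<integral>y. cnj (\<phi> y * (cnj (g (y - z)) * wave (- (y \<bullet> \<zeta>)))) \<partial>lborel)"
      unfolding stft_regular by (rule Bochner_Integration.integral_cnj[symmetric])
    then have "wave (z \<bullet> (\<eta> - \<zeta>)) * cnj (stft g (regular_distr \<phi>) z \<zeta>) =
      (\<integral>y. wave (z \<bullet> (\<eta> - \<zeta>)) * cnj (\<phi> y * (cnj (g (y - z)) * wave (- (y \<bullet> \<zeta>)))) \<partial>lborel)"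
      by (simp only: integral_mult_right_zero)
    also have "\<dots> = (\<integral>y. cnj (\<phi> y) * g (y - z) * (wave (y \<bullet> \<zeta>) * wave (z \<bullet> (\<eta> - \<zeta>))) \<partial>lborel)"
      by (intro Bochner_Integration.integral_cong refl) (simp add: mult_ac)
    finally show "wave (z \<bullet> (\<eta> - \<zeta>)) * cnj (stft g (regular_distr \<phi>) z \<zeta>) = \<dots>" .
  qed
  also have "\<dots> = (\<integral>y. (\<integral>z. cnj (\<phi> y) * g (y - z) * (wave (y \<bullet> \<zeta>) * wave (z \<bullet> (\<eta> - \<zeta>))) \<partial>lborel) \<partial>lborel)"
    by (rule lborel_pair.Fubini_integral, rule integrable_pair_convolution[OF \<phi> g]) (auto simp: norm_mult)
  also have "\<dots> = (\<integral>y. fourier g (\<eta> - \<zeta>) * cnj (\<phi> y * wave (- (y \<bullet> \<eta>))) \<partial>lborel)"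
  proof (intro Bochner_Integration.integral_cong refl)
    fix y
    have "(\<integral>z. g (y - z) * wave (z \<bullet> (\<eta> - \<zeta>)) \<partial>lborel) =
        (\<integral>z. (\<lambda>u. g u * wave ((y - u) \<bullet> (\<eta> - \<zeta>))) (y - z) \<partial>lborel)"
      by simp
    also have "\<dots> = (\<integral>u. g u * wave ((y - u) \<bullet> (\<eta> - \<zeta>)) \<partial>lborel)"
      by (rule integral_lborel_minus) simp
    also have "\<dots> = (\<integral>u. wave (y \<bullet> (\<eta> - \<zeta>)) * (g u * wave (- (u \<bullet> (\<eta> - \<zeta>)))) \<partial>lborel)"
      by (simp add: inner_diff_left wave_diff mult_ac)
    also have "\<dots> = wave (y \<bullet> (\<eta> - \<zeta>)) * fourier g (\<eta> - \<zeta>)"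
      by (simp add: fourier_def)
    finally have inner: "(\<integral>z. g (y - z) * wave (z \<bullet> (\<eta> - \<zeta>)) \<partial>lborel) = wave (y \<bullet> (\<eta> - \<zeta>)) * fourier g (\<eta> - \<zeta>)" .
    have "(\<integral>z. cnj (\<phi> y) * g (y - z) * (wave (y \<bullet> \<zeta>) * wave (z \<bullet> (\<eta> - \<zeta>))) \<partial>lborel) =
      (\<integral>z. cnj (\<phi> y) * wave (y \<bullet> \<zeta>) * (g (y - z) * wave (z \<bullet> (\<eta> - \<zeta>))) \<partial>lborel)"
      by (intro Bochner_Integration.integral_cong refl) (simp add: mult_ac)
    also have "\<dots> = cnj (\<phi> y) * wave (y \<bullet> \<zeta>) * (wave (y \<bullet> (\<eta> - \<zeta>)) * fourier g (\<eta> - \<zeta>))"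
      by (simp only: integral_mult_right_zero inner)
    also have "\<dots> = fourier g (\<eta> - \<zeta>) * cnj (\<phi> y) * (wave (y \<bullet> \<zeta>) * wave (y \<bullet> (\<eta> - \<zeta>)))"
      by (simp add: mult_ac)
    also have "wave (y \<bullet> \<zeta>) * wave (y \<bullet> (\<eta> - \<zeta>)) = wave (y \<bullet> \<eta>)"
      by (simp add: inner_diff_right flip: wave_add)
    finally show "(\<integral>z. cnj (\<phi> y) * g (y - z) * (wave (y \<bullet> \<zeta>) * wave (z \<bullet> (\<eta> - \<zeta>))) \<partial>lborel) =
      fourier g (\<eta> - \<zeta>) * cnj (\<phi> y * wave (- (y \<bullet> \<eta>)))" by (simp add: mult.assoc)
  qed
  also have "\<dots> = fourier g (\<eta> - \<zeta>) * cnj (fourier \<phi> \<eta>)"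
    by (simp add: fourier_def del: complex_cnj_mult)
  finally show ?thesis .
qed

lemma integrable_norm_fourier_square:
  assumes g: "schwartz g"
  shows "integrable lborel (\<lambda>\<xi>. (norm (fourier g \<xi>))\<^sup>2)"
proof (rule Bochner_Integration.integrable_bound)
  have [measurable]: "g \<in> borel_measurable borel" using g by (rule schwartz_measurable)
  show "integrable lborel (\<lambda>\<xi>. of_real (\<integral>x. norm (g x) \<partial>lborel) * fourier g \<xi>)"
    using rapid_integrable[OF rapid_fourier[OF g]] by simp
  show "AE \<xi> in lborel. norm ((norm (fourier g \<xi>))\<^sup>2) \<le> norm (of_real (\<integral>x. norm (g x) \<partial>lborel) * fourier g \<xi>)"
    by (auto simp: norm_mult power2_eq_square intro!: mult_right_mono order_trans[OF norm_fourier_le])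
  show "(\<lambda>\<xi>. (norm (fourier g \<xi>))\<^sup>2) \<in> borel_measurable lborel" by measurable
qed

text \<open>The orthogonality relation of the short-time Fourier transform, in the form
  \<open>\<integral>\<integral> V\<^sub>gQ \<cdot> cnj (V\<^sub>g\<phi>) = \<parallel>fourier g\<parallel>\<^sup>2 \<cdot> \<integral> m \<cdot> cnj (fourier \<phi>)\<close> for \<open>Q = inv_fourier m\<close>, which does not
  need Plancherel's theorem.\<close>

lemma stft_orthogonality_le:
  fixes g m \<phi> :: "'a::euclidean_space \<Rightarrow> complex"
  assumes g: "schwartz g" and m: "integrable lborel m" and \<phi>: "integrable lborel \<phi>"
    and bound: "\<And>z \<zeta>. norm (stft g (regular_distr \<phi>) z \<zeta>) \<le> B1 z * B2 \<zeta>"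
    and B1: "integrable lborel B1" "\<And>z. 0 < B1 z" and B2: "\<And>\<zeta>. 0 < B2 \<zeta>"
    and B2m[measurable]: "B2 \<in> borel_measurable borel"
  shows "ennreal (norm ((\<integral>\<zeta>. (norm (fourier g \<zeta>))\<^sup>2 \<partial>lborel) * (\<integral>\<eta>. m \<eta> * cnj (fourier \<phi> \<eta>) \<partial>lborel)))
    \<le> (\<integral>\<^sup>+\<zeta>. (\<integral>\<^sup>+z. ennreal (norm (stft g (regular_distr (inv_fourier m)) z \<zeta>)) * ennreal (B1 z) \<partial>lborel) * ennreal (B2 \<zeta>) \<partial>lborel)"
proof -
  have gi: "integrable lborel g" using g by (rule schwartz_integrable)
  have [measurable]: "g \<in> borel_measurable borel" "m \<in> borel_measurable borel" "\<phi> \<in> borel_measurable borel"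
    "B1 \<in> borel_measurable borel"
    using gi m \<phi> B1 by auto
  define V where "V = stft g (regular_distr (inv_fourier m))"
  define U where "U = stft g (regular_distr \<phi>)"
  have Um: "(\<lambda>(\<zeta>, z). U z \<zeta>) \<in> borel_measurable (borel \<Otimes>\<^sub>M borel)" unfolding U_def by (rule measurable_stft) auto
  have Vm[measurable]: "(\<lambda>(\<zeta>, z). V z \<zeta>) \<in> borel_measurable (borel \<Otimes>\<^sub>M borel)" unfolding V_def by (rule measurable_stft) auto
  have [measurable]: "(\<lambda>z. U z \<zeta>) \<in> borel_measurable borel" for \<zeta> using measurable_Pair2[OF Um, of \<zeta>] by simp
  have [measurable]: "(\<lambda>z. V z \<zeta>) \<in> borel_measurable borel" for \<zeta> using measurable_Pair2[OF Vm, of \<zeta>] by simp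
  \<comment> \<open>The profile \<open>B1\<close> makes the position integral absolutely convergent,
    which licenses the exchange in \<open>X\<close>.\<close>
  have Ui: "integrable lborel (\<lambda>z. U z \<zeta>)" for \<zeta>
  proof (rule Bochner_Integration.integrable_bound)
    show "integrable lborel (\<lambda>z. B1 z * B2 \<zeta>)" using B1 by simp
    show "AE z in lborel. norm (U z \<zeta>) \<le> norm (B1 z * B2 \<zeta>)"
      using bound B1(2) B2 by (auto simp: U_def less_imp_le)
  qed simp
  define C where "C = (\<integral>x. norm (g x) \<partial>lborel)"
  have C: "norm (fourier g \<xi>) \<le> C" for \<xi> unfolding C_def by (rule norm_fourier_le)
  \<comment> \<open>At a fixed frequency \<zeta> both transforms contribute a factor
    \<open>fourier g (\<eta> - \<zeta>)\<close>, one of them conjugated, whence the squared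
    modulus.\<close>
  have X: "(\<integral>z. V z \<zeta> * cnj (U z \<zeta>) \<partial>lborel) =
      (\<integral>\<eta>. m \<eta> * cnj (fourier \<phi> \<eta>) * of_real ((norm (fourier g (\<eta> - \<zeta>)))\<^sup>2) \<partial>lborel)" for \<zeta>
  proof -
    have "(\<integral>z. V z \<zeta> * cnj (U z \<zeta>) \<partial>lborel) =
      (\<integral>z. (\<integral>\<eta>. m \<eta> * cnj (fourier g (\<eta> - \<zeta>)) * (wave (z \<bullet> (\<eta> - \<zeta>)) * cnj (U z \<zeta>)) \<partial>lborel) \<partial>lborel)"
      unfolding V_def stft_inv_fourier[OF gi m] integral_mult_left_zero[symmetric] by (simp add: mult_ac)
    also have "\<dots> = (\<integral>\<eta>. (\<integral>z. m \<eta> * cnj (fourier g (\<eta> - \<zeta>)) * (wave (z \<bullet> (\<eta> - \<zeta>)) * cnj (U z \<zeta>)) \<partial>lborel) \<partial>lborel)"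
    proof (rule lborel_pair.Fubini_integral, rule integrable_pair_mult)
      show "integrable lborel (\<lambda>\<eta>. of_real C * m \<eta>)" using m by simp
      show "integrable lborel (\<lambda>z. U z \<zeta>)" by (rule Ui)
      have "norm (m \<eta>) * (norm (fourier g (\<eta> - \<zeta>)) * norm (U z \<zeta>)) \<le> \<bar>C\<bar> * norm (m \<eta>) * norm (U z \<zeta>)" for \<eta> z
        using mult_left_mono[OF mult_right_mono[OF order_trans[OF C abs_ge_self]], of "norm (U z \<zeta>)" "norm (m \<eta>)" "\<eta> - \<zeta>"]
        by (simp add: mult_ac)
      then show "norm (case (\<eta>, z) of (\<eta>, z) \<Rightarrow> m \<eta> * cnj (fourier g (\<eta> - \<zeta>)) * (wave (z \<bullet> (\<eta> - \<zeta>)) * cnj (U z \<zeta>)))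
        \<le> norm (of_real C * m \<eta>) * norm (U z \<zeta>)" for \<eta> z
        by (simp add: norm_mult mult_ac)
    qed measurable
    also have "\<dots> = (\<integral>\<eta>. m \<eta> * cnj (fourier \<phi> \<eta>) * of_real ((norm (fourier g (\<eta> - \<zeta>)))\<^sup>2) \<partial>lborel)"
      unfolding integral_mult_right_zero U_def integral_wave_cnj_stft[OF gi \<phi>] complex_norm_square
      by (simp add: mult_ac)
    finally show ?thesis .
  qed
  have g2: "integrable lborel (\<lambda>\<xi>. complex_of_real ((norm (fourier g \<xi>))\<^sup>2))"
    by (intro integrable_of_real integrable_norm_fourier_square g)
  have mf: "integrable lborel (\<lambda>\<eta>. m \<eta> * cnj (fourier \<phi> \<eta>))"
  proof (rule Bochner_Integration.integrable_bound)
    show "integrable lborel (\<lambda>\<eta>. of_real (\<integral>x. norm (\<phi> x) \<partial>lborel) * m \<eta>)" using m by simp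
    show "AE \<eta> in lborel. norm (m \<eta> * cnj (fourier \<phi> \<eta>)) \<le> norm (of_real (\<integral>x. norm (\<phi> x) \<partial>lborel) * m \<eta>)"
      using norm_fourier_le[of \<phi>] by (auto simp: norm_mult mult.commute[of "norm (m _)"] intro!: mult_right_mono order_trans[OF norm_fourier_le])
  qed measurable
  \<comment> \<open>After the exchange, the integral of the squared modulus over \<zeta> does not
    depend on \<eta> and comes out as a constant.\<close>
  have "(\<integral>\<zeta>. (\<integral>z. V z \<zeta> * cnj (U z \<zeta>) \<partial>lborel) \<partial>lborel) =
      (\<integral>\<eta>. (\<integral>\<zeta>. m \<eta> * cnj (fourier \<phi> \<eta>) * of_real ((norm (fourier g (\<eta> - \<zeta>)))\<^sup>2) \<partial>lborel) \<partial>lborel)"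
    unfolding X
    by (rule lborel_pair.Fubini_integral, rule integrable_pair_convolution[OF mf g2]) (auto simp: norm_mult)
  also have "\<dots> = (\<integral>\<eta>. m \<eta> * cnj (fourier \<phi> \<eta>) * (\<integral>\<zeta>. of_real ((norm (fourier g \<zeta>))\<^sup>2) \<partial>lborel) \<partial>lborel)"
    unfolding integral_mult_right_zero
    by (subst integral_lborel_minus[of "\<lambda>\<zeta>. of_real ((norm (fourier g \<zeta>))\<^sup>2)"]) simp_all
  also have "\<dots> = (\<integral>\<zeta>. (norm (fourier g \<zeta>))\<^sup>2 \<partial>lborel) * (\<integral>\<eta>. m \<eta> * cnj (fourier \<phi> \<eta>) \<partial>lborel)"
    by (simp add: mult.commute del: of_real_power)
  finally have "ennreal (norm ((\<integral>\<zeta>. (norm (fourier g \<zeta>))\<^sup>2 \<partial>lborel) * (\<integral>\<eta>. m \<eta> * cnj (fourier \<phi> \<eta>) \<partial>lborel)))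
      = ennreal (norm (\<integral>\<zeta>. (\<integral>z. V z \<zeta> * cnj (U z \<zeta>) \<partial>lborel) \<partial>lborel))" by simp
  also have "\<dots> \<le> (\<integral>\<^sup>+\<zeta>. ennreal (norm (\<integral>z. V z \<zeta> * cnj (U z \<zeta>) \<partial>lborel)) \<partial>lborel)"
    by (rule norm_integral_le_nn_integral)
  also have "\<dots> \<le> (\<integral>\<^sup>+\<zeta>. (\<integral>\<^sup>+z. ennreal (norm (V z \<zeta>)) * ennreal (B1 z) \<partial>lborel) * ennreal (B2 \<zeta>) \<partial>lborel)"
  proof (rule nn_integral_mono)
    fix \<zeta>
    have "ennreal (norm (\<integral>z. V z \<zeta> * cnj (U z \<zeta>) \<partial>lborel)) \<le> (\<integral>\<^sup>+z. ennreal (norm (V z \<zeta> * cnj (U z \<zeta>))) \<partial>lborel)"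
      by (rule norm_integral_le_nn_integral)
    also have "\<dots> \<le> (\<integral>\<^sup>+z. ennreal (norm (V z \<zeta>)) * ennreal (B1 z) * ennreal (B2 \<zeta>) \<partial>lborel)"
      using bound B1(2) B2 unfolding U_def
      by (intro nn_integral_mono) (auto simp: norm_mult less_imp_le mult.assoc simp flip: ennreal_mult intro!: ennreal_leI mult_left_mono)
    also have "\<dots> = (\<integral>\<^sup>+z. ennreal (norm (V z \<zeta>)) * ennreal (B1 z) \<partial>lborel) * ennreal (B2 \<zeta>)"
      by (rule nn_integral_multc) measurable
    finally show "ennreal (norm (\<integral>z. V z \<zeta> * cnj (U z \<zeta>) \<partial>lborel)) \<le>
      (\<integral>\<^sup>+z. ennreal (norm (V z \<zeta>)) * ennreal (B1 z) \<partial>lborel) * ennreal (B2 \<zeta>)" .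
  qed
  finally show ?thesis unfolding V_def .
qed

section \<open>Anisotropic Gaussians\<close>

lemma borel_measurable_projections [measurable]:
  "(fst :: 'a::euclidean_space \<times> 'b::euclidean_space \<Rightarrow> 'a) \<in> borel_measurable borel"
  "(snd :: 'a::euclidean_space \<times> 'b::euclidean_space \<Rightarrow> 'b) \<in> borel_measurable borel"
  "(prod.swap :: 'a::euclidean_space \<times> 'b::euclidean_space \<Rightarrow> 'b \<times> 'a) \<in> borel_measurable borel"
  by (intro borel_measurable_continuous_onI continuous_intros)+

lemma has_bochner_integral_pair_mult:
  fixes f g :: "'a::euclidean_space \<Rightarrow> complex"
  assumes f: "has_bochner_integral lborel f I" and g: "has_bochner_integral lborel g J"
  shows "has_bochner_integral lborel (\<lambda>z. f (fst z) * g (snd z)) (I * J)"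
proof -
  have fg: "integrable lborel f" "integral\<^sup>L lborel f = I" "integrable lborel g" "integral\<^sup>L lborel g = J"
    using f g by (auto simp: has_bochner_integral_iff)
  then have [measurable]: "f \<in> borel_measurable borel" "g \<in> borel_measurable borel" by auto
  have int: "integrable (lborel \<Otimes>\<^sub>M lborel) (\<lambda>z. f (fst z) * g (snd z))"
    by (rule integrable_pair_mult[OF fg(1,3)]) (auto simp: norm_mult)
  from lborel_pair.integral_fst'[OF this]
  have "integral\<^sup>L (lborel \<Otimes>\<^sub>M lborel) (\<lambda>z. f (fst z) * g (snd z)) = I * J"
    by (simp add: fg)
  with int show ?thesis by (simp add: has_bochner_integral_iff lborel_prod)
qed

lemma nn_integral_pair_mult:
  fixes f g :: "'a::euclidean_space \<Rightarrow> ennreal"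
  assumes [measurable]: "f \<in> borel_measurable borel" "g \<in> borel_measurable borel"
  shows "(\<integral>\<^sup>+z. f (fst z) * g (snd z) \<partial>lborel) = (\<integral>\<^sup>+x. f x \<partial>lborel) * (\<integral>\<^sup>+x. g x \<partial>lborel)"
  by (subst lborel_prod[symmetric], subst lborel.nn_integral_fst[symmetric])
    (auto simp: nn_integral_cmult nn_integral_multc)

lemma distr_swap_lborel:
  "distr lborel borel prod.swap = (lborel :: ('a::euclidean_space \<times> 'a) measure)"
proof -
  have "(lborel :: ('a \<times> 'a) measure) = distr (lborel \<Otimes>\<^sub>M lborel) (lborel \<Otimes>\<^sub>M lborel) (\<lambda>(x, y). (y, x))"
    unfolding lborel_prod[symmetric] by (rule lborel_pair.distr_pair_swap)
  also have "\<dots> = distr lborel borel prod.swap"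
    unfolding lborel_prod by (intro distr_cong) auto
  finally show ?thesis ..
qed

lemma nn_integral_lborel_swap:
  fixes f :: "'a::euclidean_space \<times> 'a \<Rightarrow> ennreal"
  assumes [measurable]: "f \<in> borel_measurable borel"
  shows "(\<integral>\<^sup>+z. f (prod.swap z) \<partial>lborel) = (\<integral>\<^sup>+z. f z \<partial>lborel)"
  by (subst (2) distr_swap_lborel[symmetric]) (simp add: nn_integral_distr)

text \<open>Used with parameters \<open>a * s\<close> and \<open>a / s\<close>: the widths are of
  order \<open>1 / s\<close> and \<open>s\<close>, but the product of the parameters, and with it
  the total mass, does not depend on \<open>s\<close>.\<close>

definition gauss2 :: "real \<Rightarrow> real \<Rightarrow> 'a::euclidean_space \<times> 'a \<Rightarrow> real" where
  "gauss2 t u z = gauss t (fst z) * gauss u (snd z)"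

lemma gauss2_pos [simp]: "0 < gauss2 t u z" "0 \<le> gauss2 t u z"
  by (simp_all add: gauss2_def)

lemma measurable_gauss2 [measurable]: "gauss2 t u \<in> borel_measurable borel"
  unfolding gauss2_def by measurable

lemma has_bochner_integral_gauss2_wave:
  fixes \<xi> :: "'a::euclidean_space \<times> 'a"
  assumes "0 < t" "0 < u"
  shows "has_bochner_integral lborel (\<lambda>z. of_real (gauss2 t u z) * wave (- (z \<bullet> \<xi>)))
    (of_real ((1 / (t * u)) ^ DIM('a) * gauss2 (1 / t) (1 / u) \<xi>))"
proof -
  have "of_real (gauss2 t u z) * wave (- (z \<bullet> \<xi>)) =
     (of_real (gauss t (fst z)) * wave (- (fst z \<bullet> fst \<xi>))) * (of_real (gauss u (snd z)) * wave (- (snd z \<bullet> snd \<xi>)))" for z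
    by (simp add: gauss2_def inner_prod_def wave_diff)
  moreover have "complex_of_real ((1 / (t * u)) ^ DIM('a) * gauss2 (1 / t) (1 / u) \<xi>) =
     of_real ((1 / t) ^ DIM('a) * gauss (1 / t) (fst \<xi>)) * of_real ((1 / u) ^ DIM('a) * gauss (1 / u) (snd \<xi>))"
    by (simp add: gauss2_def power_divide power_mult_distrib)
  ultimately show ?thesis
    using has_bochner_integral_pair_mult[OF has_bochner_integral_gauss_wave[OF assms(1)] has_bochner_integral_gauss_wave[OF assms(2)]]
    by simp
qed

lemma fourier_gauss2:
  fixes \<xi> :: "'a::euclidean_space \<times> 'a"
  assumes "0 < t" "0 < u"
  shows "fourier (\<lambda>z. of_real (gauss2 t u z)) \<xi> = of_real ((1 / (t * u)) ^ DIM('a) * gauss2 (1 / t) (1 / u) \<xi>)"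
  unfolding fourier_def using has_bochner_integral_gauss2_wave[OF assms] by (rule has_bochner_integral_integral_eq)

lemma integrable_gauss2:
  assumes "0 < t" "0 < u"
  shows "integrable lborel (\<lambda>z. complex_of_real (gauss2 t u (z :: 'a::euclidean_space \<times> 'a)))"
  using has_bochner_integral_gauss2_wave[OF assms, of "0 :: 'a \<times> 'a"] by (simp add: has_bochner_integral_iff)

text \<open>Inversion read off from the explicit transform; it brings Gaussians into the form
  required by \<open>stft_inv_fourier\<close>.\<close>

lemma gauss2_eq_inv_fourier:
  assumes "0 < t" "0 < u"
  shows "(\<lambda>z::'a::euclidean_space \<times> 'a. of_real (gauss2 t u z)) =
    inv_fourier (\<lambda>\<eta>. of_real ((1 / (t * u)) ^ DIM('a) * gauss2 (1 / t) (1 / u) \<eta>))"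
proof
  fix z :: "'a \<times> 'a"
  have "fourier (\<lambda>\<eta>. complex_of_real ((1 / (t * u)) ^ DIM('a)) * of_real (gauss2 (1 / t) (1 / u) \<eta>)) (- z) =
    of_real (gauss2 t u z)"
    unfolding fourier_cmult using assms
    by (subst fourier_gauss2) (simp_all add: gauss2_def power_divide power_mult_distrib)
  then show "of_real (gauss2 t u z) = inv_fourier (\<lambda>\<eta>. of_real ((1 / (t * u)) ^ DIM('a) * gauss2 (1 / t) (1 / u) \<eta>)) z"
    by (simp add: inv_fourier_eq_fourier)
qed

text \<open>Three powers of \<open>weight\<close> are available. Two pay for transferring the decay
  from \<open>y\<close> to \<open>z\<close> by \<open>weight_le_mult\<close>; of the third, the
  narrow Gaussian supplies integrability in the first variable, giving
  \<open>1 / s ^ DIM('a)\<close>, and \<open>h\<close> supplies it in the second. The decay is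
  squared so that one power survives the later geometric mean.\<close>

lemma gauss2_convolution_le:
  fixes h :: "'a::euclidean_space \<times> 'a \<Rightarrow> complex"
  assumes h: "rapid h" and [measurable]: "h \<in> borel_measurable borel" and a: "0 < a"
  obtains K where "0 < K"
    "\<And>s z. 1 \<le> s \<Longrightarrow> (\<integral>\<^sup>+y. ennreal (gauss2 (a * s) (a / s) y * norm (h (y - z))) \<partial>lborel)
       \<le> ennreal (K / s ^ DIM('a) / (weight (fst z) * weight ((1 / s) *\<^sub>R snd z))\<^sup>2)"
proof -
  define N where "N = (2::real) ^ DIM('a)"
  obtain H where H: "0 < H" "\<And>z. weight z ^ 3 * norm (h z) \<le> H" using rapid_weight[OF h] by blast
  obtain G where G: "0 < G" "\<And>x::'a. weight x ^ 3 * norm (complex_of_real (gauss a x)) \<le> G"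
    using rapid_weight[OF schwartz_rapid[OF schwartz_gauss[OF a]]] by blast
  have le: "gauss2 (a * s) (a / s) y * norm (h (y - z)) \<le>
     N ^ 4 * (G * G * H) / (weight (fst z) * weight ((1 / s) *\<^sub>R snd z))\<^sup>2 *
       (1 / weight (s *\<^sub>R fst y) * (1 / weight (snd y - snd z)))" if s: "1 \<le> s" for s and y z :: "'a \<times> 'a"
  proof -
    define A where "A = weight (s *\<^sub>R fst y)"
    define B where "B = weight ((1 / s) *\<^sub>R snd y)"
    define U1 where "U1 = weight (fst y - fst z)"
    define U2 where "U2 = weight (snd y - snd z)"
    define \<gamma>1 where "\<gamma>1 = gauss a (s *\<^sub>R fst y)"
    define \<gamma>2 where "\<gamma>2 = gauss a ((1 / s) *\<^sub>R snd y)"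
    define Z1 where "Z1 = weight (fst z)"
    define Z2 where "Z2 = weight ((1 / s) *\<^sub>R snd z)"
    define n where "n = norm (h (y - z))"
    note defs = A_def B_def U1_def U2_def \<gamma>1_def \<gamma>2_def Z1_def Z2_def n_def
    have pos: "0 < A" "0 < B" "0 < U1" "0 < U2" "0 < Z1" "0 < Z2" "0 \<le> n" "0 < \<gamma>1" "0 < \<gamma>2" "0 < N"
      and ge: "1 \<le> A" "1 \<le> B" "1 \<le> U1" "1 \<le> U2"
      unfolding defs N_def by (simp_all add: weight_ge_1)
    \<comment> \<open>The condition \<open>1 \<le> s\<close> enters twice: dilation by
      \<open>s\<close> can only increase \<open>weight\<close> in the narrow variable, and dilation
      by \<open>1 / s\<close> can only decrease it in the wide one.\<close>
    have "Z1 \<le> N * weight (fst y) * weight (fst z - fst y)" unfolding Z1_def N_def by (rule weight_le_mult)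
    also have "weight (fst z - fst y) = U1" using weight_minus[of "fst y - fst z"] by (simp add: U1_def)
    also have "weight (fst y) = weight (1 *\<^sub>R fst y)" by simp
    also have "N * \<dots> * U1 \<le> N * A * U1"
      unfolding A_def using s pos by (intro mult_right_mono mult_left_mono weight_scaleR_mono) auto
    finally have Z1: "Z1 \<le> N * A * U1" .
    have "Z2 \<le> N * B * weight ((1 / s) *\<^sub>R snd z - (1 / s) *\<^sub>R snd y)" unfolding Z2_def N_def B_def by (rule weight_le_mult)
    also have "weight ((1 / s) *\<^sub>R snd z - (1 / s) *\<^sub>R snd y) = weight (- ((1 / s) *\<^sub>R (snd y - snd z)))"
      by (simp add: scaleR_diff_right)
    also have "\<dots> \<le> weight (1 *\<^sub>R (snd y - snd z))"
      unfolding weight_minus using s by (intro weight_scaleR_mono) auto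
    finally have Z2: "Z2 \<le> N * B * U2" using pos by (simp add: U2_def mult_left_mono)
    have g1: "\<gamma>1 * A\<^sup>2 \<le> G * (1 / A)" using G(2)[of "s *\<^sub>R fst y"] pos
      by (simp add: \<gamma>1_def A_def field_simps power2_eq_square power3_eq_cube)
    have "\<gamma>2 * B\<^sup>2 \<le> \<gamma>2 * B ^ 3" using pos ge by (intro mult_left_mono power_increasing) auto
    also have "\<dots> \<le> G" using G(2)[of "(1 / s) *\<^sub>R snd y"] by (simp add: \<gamma>2_def B_def mult.commute)
    finally have g2: "\<gamma>2 * B\<^sup>2 \<le> G" .
    have "n * (U1\<^sup>2 * U2\<^sup>2) * U2 = n * (U1 ^ 2 * U2 ^ 3)" by (simp add: power2_eq_square power3_eq_cube)
    also have "\<dots> \<le> n * (U1 ^ 3 * U2 ^ 3)" using pos ge by (intro mult_left_mono mult_right_mono power_increasing) auto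
    also have "\<dots> \<le> H" using H(2)[of "y - z"] weight_Pair[of "fst (y - z)" "snd (y - z)"]
      unfolding prod.collapse by (simp add: n_def U1_def U2_def power_mult_distrib mult_ac)
    finally have hn: "n * (U1\<^sup>2 * U2\<^sup>2) \<le> H * (1 / U2)" using pos by (simp add: field_simps)
    have "\<gamma>1 * \<gamma>2 * n * (Z1 * Z2)\<^sup>2 \<le> \<gamma>1 * \<gamma>2 * n * ((N * A * U1) * (N * B * U2))\<^sup>2"
      using pos Z1 Z2 by (intro mult_left_mono power_mono mult_mono) auto
    also have "\<dots> = N ^ 4 * ((\<gamma>1 * A\<^sup>2) * (\<gamma>2 * B\<^sup>2) * (n * (U1\<^sup>2 * U2\<^sup>2)))"
      by (simp add: power_mult_distrib power2_eq_square power4_eq_xxxx mult_ac)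
    also have "\<dots> \<le> N ^ 4 * ((G * (1 / A)) * G * (H * (1 / U2)))"
      using pos G(1) H(1) by (intro mult_left_mono mult_mono g1 g2 hn) auto
    finally have "\<gamma>1 * \<gamma>2 * n \<le> N ^ 4 * ((G * (1 / A)) * G * (H * (1 / U2))) / (Z1 * Z2)\<^sup>2"
      using pos by (subst pos_le_divide_eq) auto
    moreover have "gauss2 (a * s) (a / s) y = \<gamma>1 * \<gamma>2" by (simp add: gauss2_def \<gamma>1_def \<gamma>2_def gauss_scaleR)
    ultimately show ?thesis by (simp add: defs mult_ac)
  qed
  define K where "K = N ^ 4 * (G * G * H) * (pi ^ DIM('a) * pi ^ DIM('a))"
  have "(\<integral>\<^sup>+y. ennreal (gauss2 (a * s) (a / s) y * norm (h (y - z))) \<partial>lborel)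
       \<le> ennreal (K / s ^ DIM('a) / (weight (fst z) * weight ((1 / s) *\<^sub>R snd z))\<^sup>2)" if s: "1 \<le> s" for s and z :: "'a \<times> 'a"
  proof -
    define Z where "Z = N ^ 4 * (G * G * H) / (weight (fst z) * weight ((1 / s) *\<^sub>R snd z))\<^sup>2"
    have Z: "0 \<le> Z" using G(1) H(1) by (simp add: Z_def N_def)
    have "(\<integral>\<^sup>+y. ennreal (gauss2 (a * s) (a / s) y * norm (h (y - z))) \<partial>lborel) \<le>
      (\<integral>\<^sup>+y. ennreal Z * (ennreal (1 / weight (s *\<^sub>R fst (y :: 'a \<times> 'a))) * ennreal (1 / weight (snd y - snd z))) \<partial>lborel)"
    proof (rule nn_integral_mono)
      fix y
      show "ennreal (gauss2 (a * s) (a / s) y * norm (h (y - z))) \<le>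
          ennreal Z * (ennreal (1 / weight (s *\<^sub>R fst y)) * ennreal (1 / weight (snd y - snd z)))"
        using ennreal_leI[OF le[OF s, of y z]] Z unfolding Z_def[symmetric] by (simp flip: ennreal_mult)
    qed
    also have "\<dots> = ennreal Z * ((\<integral>\<^sup>+x. ennreal (1 / weight (s *\<^sub>R (x :: 'a))) \<partial>lborel) * (\<integral>\<^sup>+x. ennreal (1 / weight ((x :: 'a) - snd z)) \<partial>lborel))"
      by (subst nn_integral_cmult) (auto simp: nn_integral_pair_mult[of "\<lambda>x. ennreal (1 / weight (s *\<^sub>R x))" "\<lambda>x. ennreal (1 / weight (x - snd z))"])
    also have "\<dots> = ennreal Z * ((ennreal ((1 / s) ^ DIM('a)) * ennreal (pi ^ DIM('a))) * ennreal (pi ^ DIM('a)))"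
      using s lborel_scaleR[of "\<lambda>x::'a. ennreal (1 / weight x)" s] nn_integral_lborel_diff[of "\<lambda>x::'a. ennreal (1 / weight x)" "snd z"]
      by (simp add: nn_integral_inverse_weight)
    also have "\<dots> = ennreal (Z * (((1 / s) ^ DIM('a) * pi ^ DIM('a)) * pi ^ DIM('a)))"
      using Z s by (simp add: ennreal_mult)
    also have "Z * (((1 / s) ^ DIM('a) * pi ^ DIM('a)) * pi ^ DIM('a)) = K / s ^ DIM('a) / (weight (fst z) * weight ((1 / s) *\<^sub>R snd z))\<^sup>2"
      by (simp add: Z_def K_def power_divide)
    finally show ?thesis .
  qed
  moreover have "0 < K" using G(1) H(1) by (simp add: K_def N_def)
  ultimately show ?thesis using that by blast
qed

text \<open>The Fourier transform exchanges the narrow and the wide variable, so the frequency side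
  needs the estimate with coordinates swapped.\<close>

lemma gauss2_convolution_swap_le:
  fixes h :: "'a::euclidean_space \<times> 'a \<Rightarrow> complex"
  assumes h: "rapid h" and [measurable]: "h \<in> borel_measurable borel" and a: "0 < a"
  obtains K where "0 < K"
    "\<And>s z. 1 \<le> s \<Longrightarrow> (\<integral>\<^sup>+y. ennreal (gauss2 (a / s) (a * s) y * norm (h (y - z))) \<partial>lborel)
       \<le> ennreal (K / s ^ DIM('a) / (weight (snd z) * weight ((1 / s) *\<^sub>R fst z))\<^sup>2)"
proof -
  have norm_swap: "norm (prod.swap z) = norm z" for z :: "'a \<times> 'a" by (simp add: norm_prod_def add.commute)
  have "rapid (\<lambda>z. h (prod.swap z))"
    using h unfolding rapid_def by (metis norm_swap)
  then obtain K where K: "0 < K" "\<And>s z. 1 \<le> s \<Longrightarrow> (\<integral>\<^sup>+y. ennreal (gauss2 (a * s) (a / s) y * norm (h (prod.swap (y - z)))) \<partial>lborel)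
       \<le> ennreal (K / s ^ DIM('a) / (weight (fst z) * weight ((1 / s) *\<^sub>R snd z))\<^sup>2)"
    using gauss2_convolution_le[of "\<lambda>z. h (prod.swap z)" a] a by auto
  have "(\<integral>\<^sup>+y. ennreal (gauss2 (a / s) (a * s) y * norm (h (y - z))) \<partial>lborel)
       \<le> ennreal (K / s ^ DIM('a) / (weight (snd z) * weight ((1 / s) *\<^sub>R fst z))\<^sup>2)" if "1 \<le> s" for s z
  proof -
    have "(\<integral>\<^sup>+y. ennreal (gauss2 (a / s) (a * s) y * norm (h (y - z))) \<partial>lborel) =
      (\<integral>\<^sup>+y. ennreal (gauss2 (a / s) (a * s) (prod.swap y) * norm (h (prod.swap y - z))) \<partial>lborel)"
      by (rule nn_integral_lborel_swap[symmetric]) measurable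
    also have "\<dots> = (\<integral>\<^sup>+y. ennreal (gauss2 (a * s) (a / s) y * norm (h (prod.swap (y - prod.swap z)))) \<partial>lborel)"
      by (intro nn_integral_cong) (auto simp: gauss2_def mult_ac minus_prod_def)
    also note K(2)[OF that, of "prod.swap z"]
    finally show ?thesis by simp
  qed
  with K(1) show ?thesis using that by blast
qed

text \<open>Used with \<open>c = 1 / s\<close>. The scale in the first variable is 1 and not
  \<open>1 / s\<close>, because averaging against the fixed window blurs the narrow direction to
  unit width.\<close>

definition profile :: "real \<Rightarrow> 'a::euclidean_space \<times> 'a \<Rightarrow> real" where
  "profile c z = 1 / (weight (fst z) * weight (c *\<^sub>R snd z))"

lemma profile_pos [simp]: "0 < profile c z" "0 \<le> profile c z"
  by (simp_all add: profile_def)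

lemma profile_le_1: "profile c z \<le> 1"
  unfolding profile_def using mult_mono[OF weight_ge_1 weight_ge_1, of "fst z" "c *\<^sub>R snd z"]
  by (simp add: divide_le_eq)

lemma measurable_profile [measurable]: "profile c \<in> borel_measurable borel"
  unfolding profile_def by measurable

lemma nn_integral_profile:
  assumes "0 < s"
  shows "(\<integral>\<^sup>+z. ennreal (profile (1 / s) (z :: 'a::euclidean_space \<times> 'a)) \<partial>lborel) = ennreal (pi ^ (2 * DIM('a)) * s ^ DIM('a))"
proof -
  have "(\<integral>\<^sup>+z. ennreal (profile (1 / s) (z :: 'a \<times> 'a)) \<partial>lborel) =
     (\<integral>\<^sup>+z. (\<lambda>x::'a. ennreal (1 / weight x)) (fst z) * (\<lambda>x::'a. ennreal (1 / weight ((1 / s) *\<^sub>R x))) (snd z) \<partial>lborel)"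
    by (intro nn_integral_cong) (simp add: profile_def flip: ennreal_mult)
  also have "\<dots> = ennreal (pi ^ DIM('a)) * (ennreal (s ^ DIM('a)) * ennreal (pi ^ DIM('a)))"
    using assms lborel_scaleR[of "\<lambda>x::'a. ennreal (1 / weight x)" "1 / s"]
    by (subst nn_integral_pair_mult) (simp_all add: nn_integral_inverse_weight)
  also have "\<dots> = ennreal (pi ^ (2 * DIM('a)) * s ^ DIM('a))"
    using assms by (simp add: power_mult power2_eq_square power_mult_distrib mult_ac flip: ennreal_mult)
  finally show ?thesis .
qed

lemma nn_integral_profile_swap:
  assumes "0 < s"
  shows "(\<integral>\<^sup>+z. ennreal (profile (1 / s) (prod.swap (z :: 'a::euclidean_space \<times> 'a))) \<partial>lborel) = ennreal (pi ^ (2 * DIM('a)) * s ^ DIM('a))"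
  using nn_integral_lborel_swap[of "\<lambda>z::'a \<times> 'a. ennreal (profile (1 / s) z)"] nn_integral_profile[OF assms, where 'a='a] by simp

text \<open>Both \<open>\<bar>V\<^sub>gF\<bar> \<le> \<bar>F\<bar> * \<bar>g\<bar>\<close> and the corresponding bound on the Fourier side hold; their geometric mean
  decays in both variables at the right scales.\<close>

lemma stft_gauss2_le:
  fixes g :: "'a::euclidean_space \<times> 'a \<Rightarrow> complex"
  assumes g: "schwartz g" and a: "0 < a"
  obtains K where "0 < K"
    "\<And>s z \<zeta>. 1 \<le> s \<Longrightarrow> norm (stft g (regular_distr (\<lambda>y. of_real (gauss2 (a * s) (a / s) y))) z \<zeta>)
       \<le> K / s ^ DIM('a) * profile (1 / s) z * profile (1 / s) (prod.swap \<zeta>)"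
proof -
  have [measurable]: "g \<in> borel_measurable borel" using g by (rule schwartz_measurable)
  obtain K1 where K1: "0 < K1" "\<And>s z. 1 \<le> s \<Longrightarrow> (\<integral>\<^sup>+y. ennreal (gauss2 (a * s) (a / s) y * norm (g (y - z))) \<partial>lborel)
       \<le> ennreal (K1 / s ^ DIM('a) / (weight (fst z) * weight ((1 / s) *\<^sub>R snd z))\<^sup>2)"
    using gauss2_convolution_le[OF schwartz_rapid[OF g] _ a] by auto
  obtain K2 where K2: "0 < K2" "\<And>s z. 1 \<le> s \<Longrightarrow> (\<integral>\<^sup>+y. ennreal (gauss2 ((1 / a) / s) ((1 / a) * s) y * norm (fourier g (y - z))) \<partial>lborel)
       \<le> ennreal (K2 / s ^ DIM('a) / (weight (snd z) * weight ((1 / s) *\<^sub>R fst z))\<^sup>2)"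
    using gauss2_convolution_swap_le[OF rapid_fourier[OF g], of "1 / a"] a by auto
  define K2' where "K2' = (1 / (a * a)) ^ DIM('a) * K2"
  have K2': "0 < K2'" using K2(1) a by (simp add: K2'_def)
  have "norm (stft g (regular_distr (\<lambda>y. of_real (gauss2 (a * s) (a / s) y))) z \<zeta>)
       \<le> sqrt (K1 * K2') / s ^ DIM('a) * profile (1 / s) z * profile (1 / s) (prod.swap \<zeta>)" if s: "1 \<le> s" for s z \<zeta>
  proof -
    define v where "v = norm (stft g (regular_distr (\<lambda>y. of_real (gauss2 (a * s) (a / s) y))) z \<zeta>)"
    have ts: "0 < a * s" "0 < a / s" using a s by auto
    have "ennreal v \<le> (\<integral>\<^sup>+y. ennreal (gauss2 (a * s) (a / s) y * norm (g (y - z))) \<partial>lborel)"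
      unfolding v_def stft_regular
      by (rule order_trans[OF norm_integral_le_nn_integral]) (simp add: norm_mult abs_of_pos)
    also note K1(2)[OF s]
    finally have v1: "v \<le> K1 / s ^ DIM('a) * (profile (1 / s) z)\<^sup>2"
      using K1(1) s by (simp add: profile_def power_divide power_one_over)
    have "integrable lborel (\<lambda>\<eta>. complex_of_real ((1 / (a * s * (a / s))) ^ DIM('a) * gauss2 (1 / (a * s)) (1 / (a / s)) (\<eta> :: 'a \<times> 'a)))"
      unfolding of_real_mult using a s by (intro integrable_mult_right integrable_gauss2) auto
    note V = stft_inv_fourier[OF schwartz_integrable[OF g] this]
    have "ennreal v \<le> (\<integral>\<^sup>+\<eta>. ennreal (norm (complex_of_real ((1 / (a * s * (a / s))) ^ DIM('a) * gauss2 (1 / (a * s)) (1 / (a / s)) \<eta>)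
        * (wave (z \<bullet> (\<eta> - \<zeta>)) * cnj (fourier g (\<eta> - \<zeta>))))) \<partial>lborel)"
      unfolding v_def gauss2_eq_inv_fourier[OF ts] V by (rule norm_integral_le_nn_integral)
    also have "\<dots> = (\<integral>\<^sup>+\<eta>. ennreal ((1 / (a * a)) ^ DIM('a) * gauss2 ((1 / a) / s) ((1 / a) * s) \<eta> * norm (fourier g (\<eta> - \<zeta>))) \<partial>lborel)"
      using s by (simp add: norm_mult norm_divide norm_power)
    also have "\<dots> = ennreal ((1 / (a * a)) ^ DIM('a)) * (\<integral>\<^sup>+\<eta>. ennreal (gauss2 ((1 / a) / s) ((1 / a) * s) \<eta> * norm (fourier g (\<eta> - \<zeta>))) \<partial>lborel)"
      using a by (subst nn_integral_cmult[symmetric]) (auto simp: mult.assoc simp flip: ennreal_mult)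
    also have "\<dots> \<le> ennreal ((1 / (a * a)) ^ DIM('a)) * ennreal (K2 / s ^ DIM('a) / (weight (snd \<zeta>) * weight ((1 / s) *\<^sub>R fst \<zeta>))\<^sup>2)"
      by (intro mult_left_mono K2(2) s) simp
    also have "\<dots> = ennreal (K2' / s ^ DIM('a) * (profile (1 / s) (prod.swap \<zeta>))\<^sup>2)"
      using K2(1) s a by (simp add: profile_def power_divide K2'_def power_one_over flip: ennreal_mult)
    finally have v2: "v \<le> K2' / s ^ DIM('a) * (profile (1 / s) (prod.swap \<zeta>))\<^sup>2"
      using K2' s by (simp add: profile_def)
    \<comment> \<open>Each single bound controls only one variable. Multiplying them and taking the
      square root leaves one power of each profile and one factor
      \<open>1 / s ^ DIM('a)\<close>.\<close>
    have "v\<^sup>2 \<le> (K1 / s ^ DIM('a) * (profile (1 / s) z)\<^sup>2) * (K2' / s ^ DIM('a) * (profile (1 / s) (prod.swap \<zeta>))\<^sup>2)"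
      unfolding power2_eq_square[of v] using v1 v2 K1(1) s by (intro mult_mono) (auto simp: v_def)
    also have "\<dots> = (sqrt (K1 * K2') / s ^ DIM('a) * profile (1 / s) z * profile (1 / s) (prod.swap \<zeta>))\<^sup>2"
      using K1(1) K2' by (simp add: power_mult_distrib power_divide power2_eq_square)
    finally show ?thesis
      unfolding v_def by (rule power2_le_imp_le) (use K1(1) K2' s in simp)
  qed
  moreover have "0 < sqrt (K1 * K2')" using K1(1) K2' by simp
  ultimately show ?thesis using that by blast
qed

section \<open>Modulation norms of anisotropic Gaussians\<close>

lemma integral_lborel_scaleR:
  fixes f :: "'a::euclidean_space \<Rightarrow> complex"
  assumes [measurable]: "f \<in> borel_measurable borel" and c: "0 < c"
  shows "(\<integral>x. f (c *\<^sub>R x) \<partial>lborel) = of_real ((1 / c) ^ DIM('a)) * (\<integral>x. f x \<partial>lborel)"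
proof -
  have "(\<integral>x. f x \<partial>lborel) = (\<integral>x. f x \<partial>density (distr lborel borel (\<lambda>x. 0 + c *\<^sub>R x)) (\<lambda>_. \<bar>c\<bar>^DIM('a)))"
    by (subst lborel_affine[of c 0]) (use c in auto)
  also have "\<dots> = of_real (c ^ DIM('a)) * (\<integral>x. f (c *\<^sub>R x) \<partial>lborel)"
    using c by (simp add: integral_density integral_distr scaleR_conv_of_real)
  finally show ?thesis using c by (simp add: power_divide field_simps)
qed

lemma gauss_eq_inv_fourier:
  assumes "0 < t"
  shows "(\<lambda>z::'a::euclidean_space. of_real (gauss t z)) =
    inv_fourier (\<lambda>\<eta>. of_real ((1 / t) ^ DIM('a) * gauss (1 / t) \<eta>))"
proof
  fix z :: 'a
  have "fourier (\<lambda>\<eta>. complex_of_real ((1 / t) ^ DIM('a)) * of_real (gauss (1 / t) \<eta>)) (- z) = of_real (gauss t z)"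
    unfolding fourier_cmult using assms by (subst fourier_gauss) (simp_all add: power_divide)
  then show "of_real (gauss t z) = inv_fourier (\<lambda>\<eta>. of_real ((1 / t) ^ DIM('a) * gauss (1 / t) \<eta>)) z"
    by (simp add: inv_fourier_eq_fourier)
qed

text \<open>If the Fourier transform of \<open>g\<close> vanished almost everywhere, then so would the pairings of \<open>g\<close> with
  all Gaussians, in particular with those that concentrate at a point.\<close>

lemma integral_norm_fourier_square_pos:
  fixes g :: "'a::euclidean_space \<Rightarrow> complex"
  assumes g: "schwartz g" and nz: "g \<noteq> (\<lambda>_. 0)"
  shows "0 < (\<integral>\<xi>. (norm (fourier g \<xi>))\<^sup>2 \<partial>lborel)"
proof (rule ccontr)
  have [measurable]: "g \<in> borel_measurable borel" using g by (rule schwartz_measurable)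
  obtain x0 where x0: "g x0 \<noteq> 0" using nz by auto
  assume "\<not> 0 < (\<integral>\<xi>. (norm (fourier g \<xi>))\<^sup>2 \<partial>lborel)"
  then have "(\<integral>\<xi>. (norm (fourier g \<xi>))\<^sup>2 \<partial>lborel) = 0"
    by (simp add: antisym not_less)
  then have AE0: "AE \<xi> in lborel. fourier g \<xi> = 0"
    using integral_nonneg_eq_0_iff_AE[OF integrable_norm_fourier_square[OF g]] by simp
  define G where "G = (\<lambda>n u. of_real (gauss 1 u) * cnj (g ((1 / real (Suc n)) *\<^sub>R u + x0)))"
  have zero: "(\<integral>u. G n u \<partial>lborel) = 0" for n
  proof -
    define t where "t = real (Suc n)"
    have t: "0 < t" by (simp add: t_def)
    have m: "integrable lborel (\<lambda>\<eta>::'a. complex_of_real ((1 / t) ^ DIM('a) * gauss (1 / t) \<eta>))"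
      using t by (intro integrable_of_real integrable_mult_right integrable_gauss) auto
    \<comment> \<open>At position \<open>- x0\<close> and frequency 0 this is the pairing of the
      Gaussian with the conjugate of \<open>g\<close> recentred at \<open>x0\<close>; its
      frequency-side formula contains \<open>fourier g\<close> as a factor.\<close>
    have "stft g (regular_distr (\<lambda>y. of_real (gauss t y))) (- x0) 0 = 0"
      unfolding gauss_eq_inv_fourier[OF t] stft_inv_fourier[OF schwartz_integrable[OF g] m]
      by (rule integral_eq_zero_AE, rule AE_mp[OF AE0]) simp
    then have "0 = (\<integral>y. (\<lambda>u. of_real (gauss 1 u) * cnj (g ((1 / t) *\<^sub>R u + x0))) (t *\<^sub>R y) \<partial>lborel)"
      using t by (simp add: stft_regular gauss_scaleR)
    also have "\<dots> = of_real ((1 / t) ^ DIM('a)) * (\<integral>u. G n u \<partial>lborel)"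
      unfolding G_def t_def[symmetric] by (rule integral_lborel_scaleR[OF _ t]) measurable
    finally show ?thesis using t by simp
  qed
  obtain B where B: "0 < B" "\<And>x. weight x ^ 0 * norm (g x) \<le> B"
    using rapid_weight[OF schwartz_rapid[OF g]] by blast
  have "(\<lambda>n. \<integral>u. G n u \<partial>lborel) \<longlonglongrightarrow> (\<integral>u. of_real (gauss 1 u) * cnj (g (0 *\<^sub>R u + x0)) \<partial>lborel)"
  proof (rule integral_dominated_convergence[where w="\<lambda>u. gauss 1 u * B"])
    show "integrable lborel (\<lambda>u::'a. gauss 1 u * B)" by (intro integrable_mult_left integrable_gauss) simp
    have "(\<lambda>n. G n u) \<longlonglongrightarrow> of_real (gauss 1 u) * cnj (g (0 *\<^sub>R u + x0))" for u
    proof -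
      have "(\<lambda>n. (1 / real (Suc n)) *\<^sub>R u + x0) \<longlonglongrightarrow> 0 *\<^sub>R u + x0"
        using LIMSEQ_inverse_real_of_nat by (intro tendsto_intros) (simp add: inverse_eq_divide)
      moreover have "isCont g (0 *\<^sub>R u + x0)" using schwartz_continuous[OF g, of UNIV] by (simp add: continuous_on_eq_continuous_at)
      ultimately have "(\<lambda>n. g ((1 / real (Suc n)) *\<^sub>R u + x0)) \<longlonglongrightarrow> g (0 *\<^sub>R u + x0)"
        by (rule isCont_tendsto_compose[rotated])
      then show ?thesis unfolding G_def by (intro tendsto_mult tendsto_const tendsto_cnj)
    qed
    then show "AE u in lborel. (\<lambda>n. G n u) \<longlonglongrightarrow> of_real (gauss 1 u) * cnj (g (0 *\<^sub>R u + x0))" by simp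
    show "AE u in lborel. norm (G n u) \<le> gauss 1 u * B" for n
      using B(2) by (simp add: G_def norm_mult abs_of_pos)
  qed (unfold G_def, measurable)
  then have "(\<integral>u. complex_of_real (gauss 1 (u :: 'a)) * cnj (g x0) \<partial>lborel) = 0"
    unfolding zero by (simp add: LIMSEQ_const_iff)
  moreover have "(\<integral>u. complex_of_real (gauss 1 (u :: 'a)) \<partial>lborel) = 1"
    using fourier_gauss[of 1 "0 :: 'a"] by (simp add: fourier_def gauss_def)
  ultimately show False using x0 by simp
qed

lemma nn_integral_cmult_profile:
  assumes "0 < s" "0 \<le> c"
  shows "(\<integral>\<^sup>+z. ennreal (c / s ^ DIM('a) * profile (1 / s) (z :: 'a::euclidean_space \<times> 'a)) \<partial>lborel)
    = ennreal (c * pi ^ (2 * DIM('a)))"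
proof -
  have "(\<integral>\<^sup>+z. ennreal (c / s ^ DIM('a) * profile (1 / s) (z :: 'a \<times> 'a)) \<partial>lborel) =
    (\<integral>\<^sup>+z. ennreal (c / s ^ DIM('a)) * ennreal (profile (1 / s) (z :: 'a \<times> 'a)) \<partial>lborel)"
    using assms by (intro nn_integral_cong ennreal_mult) auto
  also have "\<dots> = ennreal (c / s ^ DIM('a)) * ennreal (pi ^ (2 * DIM('a)) * s ^ DIM('a))"
    using nn_integral_profile[OF assms(1), where 'a='a] by (subst nn_integral_cmult) auto
  also have "\<dots> = ennreal (c * pi ^ (2 * DIM('a)))"
    using assms by (simp flip: ennreal_mult)
  finally show ?thesis .
qed

lemma stft_cmult: "stft g (regular_distr (\<lambda>y. c * F y)) z \<zeta> = c * stft g (regular_distr F) z \<zeta>"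
  unfolding stft_regular by (simp add: mult.assoc)

text \<open>Interpolates a profile of height \<open>x / S\<close> and mass \<open>x * P\<close>.
  This fixes the power of \<open>S\<close> coming from the position variable.\<close>

lemma powr_scaled:
  fixes x S P r :: real
  assumes "0 < x" "0 < S" "0 < P"
  shows "(x / S) powr (1 - r) * (x * P) powr r = x * P powr r * S powr (r - 1)"
  using assms by (simp add: powr_mult powr_divide powr_diff)

text \<open>In position the majorant has height of order \<open>1 / S\<close> and bounded mass,
  giving \<open>S^(1/p - 1)\<close>; in frequency it has height 1 and mass of order
  \<open>S\<close>, giving \<open>S^(1/q)\<close>. Here \<open>S\<close> is
  \<open>s ^ DIM('a)\<close>.\<close>

lemma modulation_norm_gauss2_le:
  fixes g :: "'a::euclidean_space \<times> 'a \<Rightarrow> complex"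
  assumes g: "schwartz g" and a: "0 < a" and p: "1 \<le> p" and q: "1 \<le> q"
  obtains K where "0 < K" "\<And>s A. 1 \<le> s \<Longrightarrow> 0 < A \<Longrightarrow>
    modulation_norm g p q (regular_distr (\<lambda>y. of_real A * of_real (gauss2 (a * s) (a / s) y)))
      \<le> ennreal (A * (K * (s ^ DIM('a)) powr (1 / enn2real p + 1 / enn2real q - 1)))"
proof -
  have [measurable]: "g \<in> borel_measurable borel" using g by (rule schwartz_measurable)
  obtain K where K: "0 < K" "\<And>s z \<zeta>. 1 \<le> s \<Longrightarrow> norm (stft g (regular_distr (\<lambda>y. of_real (gauss2 (a * s) (a / s) y))) z \<zeta>)
       \<le> K / s ^ DIM('a) * profile (1 / s) z * profile (1 / s) (prod.swap \<zeta>)"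
    using stft_gauss2_le[OF g a] by blast
  define P where "P = pi ^ (2 * DIM('a))"
  have P: "0 < P" by (simp add: P_def)
  define r where "r = 1 / enn2real p"
  define r' where "r' = 1 / enn2real q"
  have "modulation_norm g p q (regular_distr (\<lambda>y. of_real A * of_real (gauss2 (a * s) (a / s) y)))
      \<le> ennreal (A * (K * P powr r * P powr r' * (s ^ DIM('a)) powr (r + r' - 1)))" if s: "1 \<le> s" and A: "0 < A" for s A
  proof -
    define S where "S = s ^ DIM('a)"
    have S: "0 < S" using s by (simp add: S_def)
    have "modulation_norm g p q (regular_distr (\<lambda>y. of_real A * of_real (gauss2 (a * s) (a / s) y)))
      \<le> ennreal ((A * K / S) powr (1 - 1 / enn2real p) * (A * K * P) powr (1 / enn2real p)
           * (1 powr (1 - 1 / enn2real q) * (P * S) powr (1 / enn2real q)))"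
      unfolding modulation_norm_def
    proof (rule mixed_norm_le[where ?B1.0="\<lambda>z. A * K / S * profile (1 / s) z" and ?B2.0="\<lambda>\<zeta>. profile (1 / s) (prod.swap \<zeta>)"])
      show "(\<lambda>(\<zeta>, z). stft g (regular_distr (\<lambda>y. of_real A * of_real (gauss2 (a * s) (a / s) y))) z \<zeta>) \<in> borel_measurable (borel \<Otimes>\<^sub>M borel)"
        by (rule measurable_stft) measurable
      show "norm (stft g (regular_distr (\<lambda>y. of_real A * of_real (gauss2 (a * s) (a / s) y))) z \<zeta>)
        \<le> A * K / S * profile (1 / s) z * profile (1 / s) (prod.swap \<zeta>)" for z \<zeta>
        using mult_left_mono[OF K(2)[OF s, of z \<zeta>], of A] A by (simp add: stft_cmult norm_mult S_def mult.assoc)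
      show "(\<integral>\<^sup>+z. ennreal (A * K / S * profile (1 / s) (z :: 'a \<times> 'a)) \<partial>lborel) \<le> ennreal (A * K * P)"
        using nn_integral_cmult_profile[of s "A * K", where 'a='a] s A K(1) by (simp add: S_def P_def)
      show "A * K / S * profile (1 / s) z \<le> A * K / S" for z :: "'a \<times> 'a"
        using A K(1) S by (intro mult_left_le profile_le_1) auto
      show "(\<integral>\<^sup>+\<zeta>. ennreal (profile (1 / s) (prod.swap (\<zeta> :: 'a \<times> 'a))) \<partial>lborel) \<le> ennreal (P * S)"
        using s nn_integral_profile_swap[of s, where 'a='a] by (simp add: P_def S_def)
    qed (use A K(1) S P p q profile_le_1 in \<open>auto simp: divide_pos_pos\<close>)
    also have "(A * K / S) powr (1 - 1 / enn2real p) * (A * K * P) powr (1 / enn2real p)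
           * (1 powr (1 - 1 / enn2real q) * (P * S) powr (1 / enn2real q)) =
        A * (K * P powr r * P powr r' * (S powr (r - 1) * S powr r'))"
      using powr_scaled[of "A * K" S P r] A K(1) S P
      unfolding r_def[symmetric] r'_def[symmetric] by (simp add: powr_mult mult_ac)
    also have "S powr (r - 1) * S powr r' = S powr (r + r' - 1)" by (simp add: algebra_simps flip: powr_add)
    finally show ?thesis by (simp add: S_def)
  qed
  moreover have "0 < K * P powr r * P powr r'" using K(1) P by simp
  ultimately show ?thesis using that[of "K * P powr r * P powr r'"] unfolding r_def r'_def by blast
qed

text \<open>The lower bound for modulation norms: the orthogonality relation turns the pairing into
  one of short-time transforms, and the profiles of the test Gaussian act as the weights in
  Hoelder's inequality. Conjugate exponents give \<open>S^(-1/p)\<close> in position and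
  \<open>S^(1 - 1/q)\<close> in frequency.\<close>

lemma pairing_le_modulation_norm:
  fixes g :: "'a::euclidean_space \<times> 'a \<Rightarrow> complex"
  assumes g: "schwartz g" "g \<noteq> (\<lambda>_. 0)" and a: "0 < a" and p: "1 \<le> p" and q: "1 \<le> q"
  obtains K where "0 < K" "\<And>s m. 1 \<le> s \<Longrightarrow> integrable lborel m \<Longrightarrow>
    ennreal (norm (\<integral>\<eta>. m \<eta> * of_real (gauss2 (1 / (a * s)) (1 / (a / s)) \<eta>) \<partial>lborel))
      \<le> ennreal (K * (s ^ DIM('a)) powr (1 - 1 / enn2real p - 1 / enn2real q)) *
        modulation_norm g p q (regular_distr (inv_fourier m))"
proof -
  have [measurable]: "g \<in> borel_measurable borel" using g by (auto intro: schwartz_measurable)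
  obtain K where K: "0 < K" "\<And>s z \<zeta>. 1 \<le> s \<Longrightarrow> norm (stft g (regular_distr (\<lambda>y. of_real (gauss2 (a * s) (a / s) y))) z \<zeta>)
       \<le> K / s ^ DIM('a) * profile (1 / s) z * profile (1 / s) (prod.swap \<zeta>)"
    using stft_gauss2_le[OF g(1) a] by blast
  define P where "P = pi ^ (2 * DIM('a))"
  have P: "0 < P" by (simp add: P_def)
  define r where "r = 1 / enn2real p"
  define r' where "r' = 1 / enn2real q"
  \<comment> \<open>The constant of the orthogonality relation times the scalar in front of the
    transformed test Gaussian. It is free of \<open>s\<close>, and the nonzero window makes it
    positive.\<close>
  define \<kappa> where "\<kappa> = (\<integral>\<xi>. (norm (fourier g \<xi>))\<^sup>2 \<partial>lborel) * (1 / (a * a)) ^ DIM('a)"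
  have \<kappa>: "0 < \<kappa>" unfolding \<kappa>_def using a integral_norm_fourier_square_pos[OF g] by simp
  define c where "c = 4 * (K * P powr (1 - r) * P powr (1 - r'))"
  have c: "0 < c" using K(1) P by (simp add: c_def)
  have "ennreal (norm (\<integral>\<eta>. m \<eta> * of_real (gauss2 (1 / (a * s)) (1 / (a / s)) \<eta>) \<partial>lborel))
      \<le> ennreal (c / \<kappa> * (s ^ DIM('a)) powr (1 - r - r')) * modulation_norm g p q (regular_distr (inv_fourier m))"
    if s: "1 \<le> s" and m: "integrable lborel m" for s m
  proof -
    have [measurable]: "m \<in> borel_measurable borel" using m by auto
    define S where "S = s ^ DIM('a)"
    have S: "0 < S" using s by (simp add: S_def)
    define v where "v = norm (\<integral>\<eta>. m \<eta> * of_real (gauss2 (1 / (a * s)) (1 / (a / s)) \<eta>) \<partial>lborel)"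
    define \<phi> where "\<phi> = (\<lambda>y::'a \<times> 'a. complex_of_real (gauss2 (a * s) (a / s) y))"
    have \<phi>i: "integrable lborel \<phi>" unfolding \<phi>_def using a s by (intro integrable_gauss2) auto
    have \<phi>f: "fourier \<phi> \<eta> = of_real ((1 / (a * a)) ^ DIM('a)) * of_real (gauss2 (1 / (a * s)) (1 / (a / s)) \<eta>)" for \<eta>
      unfolding \<phi>_def using a s by (subst fourier_gauss2) auto
    have bound1: "(\<integral>\<^sup>+z. ennreal (K / S * profile (1 / s) (z :: 'a \<times> 'a)) \<partial>lborel) \<le> ennreal (K * P)"
      using nn_integral_cmult_profile[of s K, where 'a='a] s K(1) by (simp add: S_def P_def)
    have bound2: "(\<integral>\<^sup>+\<zeta>. ennreal (profile (1 / s) (prod.swap (\<zeta> :: 'a \<times> 'a))) \<partial>lborel) \<le> ennreal (P * S)"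
      using s nn_integral_profile_swap[of s, where 'a='a] by (simp add: P_def S_def)
    have "ennreal (\<kappa> * v) = ennreal (norm ((\<integral>\<zeta>. (norm (fourier g \<zeta>))\<^sup>2 \<partial>lborel) * (\<integral>\<eta>. m \<eta> * cnj (fourier \<phi> \<eta>) \<partial>lborel)))"
    proof -
      have "(\<integral>\<eta>. m \<eta> * cnj (fourier \<phi> \<eta>) \<partial>lborel) =
        (\<integral>\<eta>. of_real ((1 / (a * a)) ^ DIM('a)) * (m \<eta> * of_real (gauss2 (1 / (a * s)) (1 / (a / s)) \<eta>)) \<partial>lborel)"
        unfolding \<phi>f by (intro Bochner_Integration.integral_cong refl) (simp add: mult_ac)
      then have "norm (\<integral>\<eta>. m \<eta> * cnj (fourier \<phi> \<eta>) \<partial>lborel) = (1 / (a * a)) ^ DIM('a) * v"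
        unfolding integral_mult_right_zero v_def by (simp add: norm_mult norm_divide norm_power power_divide)
      then show ?thesis
        using integral_norm_fourier_square_pos[OF g] by (simp only: norm_mult norm_of_real \<kappa>_def) (simp add: mult.assoc)
    qed
    also have "\<dots> \<le> (\<integral>\<^sup>+\<zeta>. (\<integral>\<^sup>+z. ennreal (norm (stft g (regular_distr (inv_fourier m)) z \<zeta>)) *
        ennreal (K / S * profile (1 / s) z) \<partial>lborel) * ennreal (profile (1 / s) (prod.swap \<zeta>)) \<partial>lborel)"
    proof (rule stft_orthogonality_le[OF g(1) m \<phi>i])
      show "norm (stft g (regular_distr \<phi>) z \<zeta>) \<le> K / S * profile (1 / s) z * profile (1 / s) (prod.swap \<zeta>)" for z \<zeta>
        using K(2)[OF s, of z \<zeta>] by (simp add: \<phi>_def S_def)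
      show "integrable lborel (\<lambda>z::'a \<times> 'a. K / S * profile (1 / s) z)"
        by (rule integrableI_nn_integral_finite[where x="K * P"])
          (use nn_integral_cmult_profile[of s K, where 'a='a] s K(1) S in \<open>auto simp: S_def P_def\<close>)
    qed (use K(1) S in auto)
    also have "\<dots> \<le> ennreal (4 * ((K / S) powr (1 / enn2real p) * (K * P) powr (1 - 1 / enn2real p)
      * (1 powr (1 / enn2real q) * (P * S) powr (1 - 1 / enn2real q))))
      * modulation_norm g p q (regular_distr (inv_fourier m))"
      unfolding modulation_norm_def
    proof (rule nn_integral_le_mixed_norm[OF _ _ _ bound1 _ _ _ bound2])
      show "(\<lambda>(\<zeta>, z). stft g (regular_distr (inv_fourier m)) z \<zeta>) \<in> borel_measurable (borel \<Otimes>\<^sub>M borel)"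
        by (rule measurable_stft) measurable
      show "K / S * profile (1 / s) z \<le> K / S" for z :: "'a \<times> 'a"
        using K(1) S by (intro mult_left_le profile_le_1) auto
    qed (use K(1) S P p q profile_le_1 in \<open>auto simp: divide_pos_pos\<close>)
    also have "4 * ((K / S) powr (1 / enn2real p) * (K * P) powr (1 - 1 / enn2real p)
      * (1 powr (1 / enn2real q) * (P * S) powr (1 - 1 / enn2real q))) = c * (S powr (- r) * S powr (1 - r'))"
      using powr_scaled[of K S P "1 - r"] K(1) S P
      unfolding r_def[symmetric] r'_def[symmetric] c_def by (simp add: powr_mult mult_ac)
    also have "S powr (- r) * S powr (1 - r') = S powr (1 - r - r')" by (simp add: algebra_simps flip: powr_add)
    finally have "ennreal (1 / \<kappa>) * ennreal (\<kappa> * v) \<le> ennreal (1 / \<kappa>) * (ennreal (c * S powr (1 - r - r')) * modulation_norm g p q (regular_distr (inv_fourier m)))"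
      by (rule mult_left_mono) simp
    moreover have "ennreal (1 / \<kappa>) * ennreal (\<kappa> * v) = ennreal v"
      using \<kappa> by (simp add: v_def flip: ennreal_mult)
    moreover have "ennreal (1 / \<kappa>) * (ennreal (c * S powr (1 - r - r')) * modulation_norm g p q (regular_distr (inv_fourier m))) =
      ennreal (c / \<kappa> * S powr (1 - r - r')) * modulation_norm g p q (regular_distr (inv_fourier m))"
      using \<kappa> c by (simp add: mult.assoc[symmetric] flip: ennreal_mult)
    ultimately show ?thesis by (simp add: v_def S_def)
  qed
  moreover have "0 < c / \<kappa>" using c \<kappa> by simp
  ultimately show ?thesis using that[of "c / \<kappa>"] unfolding r_def r'_def by blast
qed

section \<open>The oscillating factor\<close>

lemma nsinc_eq_sinc: "nsinc t = sinc (pi * t)"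
  by (simp add: nsinc_def)

lemma measurable_nsinc [measurable]: "nsinc \<in> borel_measurable borel"
  unfolding nsinc_def by measurable

lemma abs_nsinc_le_1: "\<bar>nsinc t\<bar> \<le> 1"
proof (cases "t = 0")
  case False
  then have "0 < \<bar>pi * t\<bar>" by simp
  then show ?thesis using abs_sin_x_le_abs_x[of "pi * t"] False by (simp add: nsinc_def divide_le_eq)
qed (simp add: nsinc_def)

lemma nsinc_minus [simp]: "nsinc (- t) = nsinc t"
  by (simp add: nsinc_def)

lemma nsinc_0 [simp]: "nsinc 0 = 1"
  by (simp add: nsinc_def)

lemma isCont_nsinc: "isCont nsinc t"
proof -
  have "continuous_on UNIV (\<lambda>t. sinc (pi * t))" by (intro continuous_on_sinc continuous_intros)
  then show ?thesis unfolding nsinc_eq_sinc[symmetric] by (simp add: continuous_on_eq_continuous_at)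
qed

text \<open>The Fourier-side integrand; \<tau> = 1 corresponds to \<open>Theta ^ n\<close>. The
  extra parameter makes the family closed under dilation of either variable.\<close>

definition oscillation :: "nat \<Rightarrow> real \<Rightarrow> real \<Rightarrow> real \<Rightarrow> 'a::euclidean_space \<times> 'a \<Rightarrow> complex" where
  "oscillation n \<tau> t u z = of_real (nsinc (\<tau> * (fst z \<bullet> snd z)) ^ n * gauss2 t u z)"

lemma measurable_oscillation [measurable]: "oscillation n \<tau> t u \<in> borel_measurable borel"
  unfolding oscillation_def by measurable

lemma norm_oscillation_le: "norm (oscillation n \<tau> t u z) \<le> gauss2 t u z"
  by (simp add: oscillation_def norm_mult norm_power abs_of_pos power_le_one abs_nsinc_le_1 mult_left_le_one_le)

lemma integrable_oscillation:
  assumes "0 < t" "0 < u"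
  shows "integrable lborel (oscillation n \<tau> t u :: 'a::euclidean_space \<times> 'a \<Rightarrow> complex)"
  by (rule Bochner_Integration.integrable_bound[OF integrable_gauss2[OF assms]])
    (auto simp: norm_oscillation_le abs_of_pos)

text \<open>Dilating the two variables in turn changes the bilinear form by
  \<open>1 / (t * u)\<close>. Only that product enters, so \<open>s\<close> disappears for the
  parameters \<open>b / s\<close> and \<open>b * s\<close>.\<close>

lemma integral_oscillation_scale:
  assumes "0 < t" "0 < u"
  shows "(\<integral>z. oscillation n \<tau> t u (z :: 'a::euclidean_space \<times> 'a) \<partial>lborel) =
    of_real ((1 / (t * u)) ^ DIM('a)) * (\<integral>z. oscillation n (\<tau> / (t * u)) 1 1 (z :: 'a \<times> 'a) \<partial>lborel)"
proof -
  have sec: "(\<lambda>x. oscillation n \<tau> t u (x, y)) \<in> borel_measurable borel" "(\<lambda>x. oscillation n \<tau> t u (y, x)) \<in> borel_measurable borel"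
    for \<tau> t u and y :: 'a
    unfolding oscillation_def gauss2_def by measurable
  have fst: "(\<integral>z. oscillation n \<tau> t u (z :: 'a \<times> 'a) \<partial>lborel) =
    of_real ((1 / t) ^ DIM('a)) * (\<integral>z. oscillation n (\<tau> / t) 1 u (z :: 'a \<times> 'a) \<partial>lborel)"
    if "0 < t" "0 < u" for \<tau> t u
  proof -
    have int: "integrable (lborel \<Otimes>\<^sub>M lborel) (\<lambda>(x, y). oscillation n \<tau> t u (x :: 'a, y))" if "0 < t" "0 < u" for \<tau> t u
      using integrable_oscillation[OF that, where 'a='a] by (simp add: lborel_prod)
    have it: "(\<integral>z. oscillation n \<tau> t u (z :: 'a \<times> 'a) \<partial>lborel) = (\<integral>y. (\<integral>x. oscillation n \<tau> t u (x :: 'a, y) \<partial>lborel) \<partial>lborel)"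
      if "0 < t" "0 < u" for \<tau> t u
      using lborel_pair.integral_snd[OF int[OF that]] by (simp add: lborel_prod)
    have "(\<integral>x. oscillation n \<tau> t u (x, y) \<partial>lborel) = of_real ((1 / t) ^ DIM('a)) * (\<integral>x. oscillation n (\<tau> / t) 1 u (x, y) \<partial>lborel)" for y :: 'a
    proof -
      have "(\<integral>x. oscillation n \<tau> t u (x, y) \<partial>lborel) = (\<integral>x. (\<lambda>x. oscillation n (\<tau> / t) 1 u (x, y)) (t *\<^sub>R x) \<partial>lborel)"
        using \<open>0 < t\<close> by (simp add: oscillation_def gauss2_def gauss_scaleR)
      also have "\<dots> = of_real ((1 / t) ^ DIM('a)) * (\<integral>x. oscillation n (\<tau> / t) 1 u (x, y) \<partial>lborel)"
        by (rule integral_lborel_scaleR[OF sec(1) \<open>0 < t\<close>])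
      finally show ?thesis .
    qed
    then show ?thesis using that by (simp add: it)
  qed
  have snd: "(\<integral>z. oscillation n \<tau> t u (z :: 'a \<times> 'a) \<partial>lborel) =
    of_real ((1 / u) ^ DIM('a)) * (\<integral>z. oscillation n (\<tau> / u) t 1 (z :: 'a \<times> 'a) \<partial>lborel)"
    if "0 < t" "0 < u" for \<tau> t u
  proof -
    have int: "integrable (lborel \<Otimes>\<^sub>M lborel) (\<lambda>(x, y). oscillation n \<tau> t u (x :: 'a, y))" if "0 < t" "0 < u" for \<tau> t u
      using integrable_oscillation[OF that, where 'a='a] by (simp add: lborel_prod)
    have it: "(\<integral>z. oscillation n \<tau> t u (z :: 'a \<times> 'a) \<partial>lborel) = (\<integral>x. (\<integral>y. oscillation n \<tau> t u (x :: 'a, y) \<partial>lborel) \<partial>lborel)"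
      if "0 < t" "0 < u" for \<tau> t u
      using lborel_pair.integral_fst[OF int[OF that]] by (simp add: lborel_prod)
    have "(\<integral>y. oscillation n \<tau> t u (x, y) \<partial>lborel) = of_real ((1 / u) ^ DIM('a)) * (\<integral>y. oscillation n (\<tau> / u) t 1 (x, y) \<partial>lborel)" for x :: 'a
    proof -
      have "(\<integral>y. oscillation n \<tau> t u (x, y) \<partial>lborel) = (\<integral>y. (\<lambda>y. oscillation n (\<tau> / u) t 1 (x, y)) (u *\<^sub>R y) \<partial>lborel)"
        using \<open>0 < u\<close> by (simp add: oscillation_def gauss2_def gauss_scaleR)
      also have "\<dots> = of_real ((1 / u) ^ DIM('a)) * (\<integral>y. oscillation n (\<tau> / u) t 1 (x, y) \<partial>lborel)"
        by (rule integral_lborel_scaleR[OF sec(2) \<open>0 < u\<close>])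
      finally show ?thesis .
    qed
    then show ?thesis using that by (simp add: it)
  qed
  show ?thesis using assms by (simp add: fst[of t u] snd[of 1 u] power_divide power_mult_distrib)
qed

text \<open>As \<open>b\<close> grows, the multiplier tends pointwise to
  \<open>nsinc 0 ^ n = 1\<close> and the integral to the Gaussian mass 1. The bound
  \<open>1 \<le> b\<close> later makes \<open>b^2 - 1/2\<close> positive.\<close>

lemma oscillation_nonzero:
  obtains b :: real where "1 \<le> b" "(\<integral>z. oscillation n (1 / (b * b)) 1 1 (z :: 'a::euclidean_space \<times> 'a) \<partial>lborel) \<noteq> 0"
proof -
  have "(\<lambda>k. \<integral>z. oscillation n (1 / (real (Suc k) * real (Suc k))) 1 1 (z :: 'a \<times> 'a) \<partial>lborel)
      \<longlonglongrightarrow> (\<integral>z. of_real (gauss2 1 1 (z :: 'a \<times> 'a)) \<partial>lborel)"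
  proof (rule integral_dominated_convergence[where w="gauss2 1 1"])
    show "integrable lborel (gauss2 1 1 :: 'a \<times> 'a \<Rightarrow> real)"
      using integrable_gauss2[of 1 1, where 'a='a] by (simp only: complex_of_real_integrable_eq)
    have "(\<lambda>k. oscillation n (1 / (real (Suc k) * real (Suc k))) 1 1 z) \<longlonglongrightarrow> of_real (gauss2 1 1 z)" for z :: "'a \<times> 'a"
    proof -
      have "(\<lambda>k. 1 / real (Suc k) * (1 / real (Suc k)) * (fst z \<bullet> snd z)) \<longlonglongrightarrow> 0 * 0 * (fst z \<bullet> snd z)"
        using LIMSEQ_inverse_real_of_nat by (intro tendsto_mult tendsto_const) (simp_all add: inverse_eq_divide)
      then have "(\<lambda>k. nsinc (1 / real (Suc k) * (1 / real (Suc k)) * (fst z \<bullet> snd z))) \<longlonglongrightarrow> nsinc (0 * 0 * (fst z \<bullet> snd z))"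
        by (rule isCont_tendsto_compose[OF isCont_nsinc])
      then have "(\<lambda>k. complex_of_real (nsinc (1 / real (Suc k) * (1 / real (Suc k)) * (fst z \<bullet> snd z)) ^ n * gauss2 1 1 z))
        \<longlonglongrightarrow> of_real (nsinc (0 * 0 * (fst z \<bullet> snd z)) ^ n * gauss2 1 1 z)"
        by (intro tendsto_of_real tendsto_mult tendsto_power tendsto_const)
      then show ?thesis by (simp add: oscillation_def)
    qed
    then show "AE z in lborel. (\<lambda>k. oscillation n (1 / (real (Suc k) * real (Suc k))) 1 1 (z :: 'a \<times> 'a)) \<longlonglongrightarrow> of_real (gauss2 1 1 z)" by simp
  qed (simp_all add: norm_oscillation_le)
  moreover have "(\<integral>z. complex_of_real (gauss2 1 1 (z :: 'a \<times> 'a)) \<partial>lborel) = 1"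
    using fourier_gauss2[of 1 1 "0 :: 'a \<times> 'a"] by (simp add: fourier_def gauss2_def gauss_def)
  ultimately have "\<forall>\<^sub>F k in sequentially. (\<integral>z. oscillation n (1 / (real (Suc k) * real (Suc k))) 1 1 (z :: 'a \<times> 'a) \<partial>lborel) \<noteq> 0"
    by (intro tendsto_imp_eventually_ne) auto
  then obtain k where "(\<integral>z. oscillation n (1 / (real (Suc k) * real (Suc k))) 1 1 (z :: 'a \<times> 'a) \<partial>lborel) \<noteq> 0"
    unfolding eventually_sequentially by auto
  then show ?thesis using that[of "real (Suc k)"] by simp
qed

section \<open>The Wigner and Born--Jordan distributions of a Gaussian\<close>

lemma gauss_mult: "gauss t x * gauss u x = gauss (sqrt (t\<^sup>2 + u\<^sup>2)) x"
  by (simp add: gauss_def power_mult_distrib distrib_left distrib_right flip: exp_add)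

lemma gauss2_mult: "gauss2 t u z * gauss2 t' u' z = gauss2 (sqrt (t\<^sup>2 + t'\<^sup>2)) (sqrt (u\<^sup>2 + u'\<^sup>2)) z"
  by (simp add: gauss2_def gauss_mult[symmetric])

text \<open>By the parallelogram law the product of the two shifted Gaussians separates into one in
  \<open>x\<close> and one in \<open>y\<close>; the latter is then Fourier transformed.\<close>

lemma wigner_gauss:
  assumes s: "0 < s"
  shows "wigner (\<lambda>x :: real^'d. of_real (gauss s x)) =
    (\<lambda>z. of_real ((sqrt 2 / s) ^ CARD('d)) * of_real (gauss2 (sqrt 2 * s) (sqrt 2 / s) z))"
proof
  fix z :: "(real^'d) \<times> (real^'d)"
  obtain x \<omega> where z: "z = (x, \<omega>)" by (cases z)
  have prod: "gauss s (x + y /\<^sub>R 2) * gauss s (x - y /\<^sub>R 2) = gauss (sqrt 2 * s) x * gauss (s / sqrt 2) y" for y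
  proof -
    have "(norm (x + y /\<^sub>R 2))\<^sup>2 + (norm (x - y /\<^sub>R 2))\<^sup>2 = 2 * (norm x)\<^sup>2 + (norm y)\<^sup>2 / 2"
      by (simp add: power2_norm_eq_inner inner_add_left inner_add_right inner_diff_left inner_diff_right inner_commute)
    then have "pi * s\<^sup>2 * ((norm (x + y /\<^sub>R 2))\<^sup>2 + (norm (x - y /\<^sub>R 2))\<^sup>2) = pi * s\<^sup>2 * (2 * (norm x)\<^sup>2 + (norm y)\<^sup>2 / 2)"
      by (rule arg_cong)
    then have "- (pi * (s * norm (x + y /\<^sub>R 2))\<^sup>2) + - (pi * (s * norm (x - y /\<^sub>R 2))\<^sup>2) =
      - (pi * (sqrt 2 * s * norm x)\<^sup>2) + - (pi * (s / sqrt 2 * norm y)\<^sup>2)"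
      by (simp add: power_mult_distrib power_divide algebra_simps)
    then show ?thesis unfolding gauss_def exp_add[symmetric] by simp
  qed
  have "wigner (\<lambda>x :: real^'d. of_real (gauss s x)) z =
    (\<integral>y. of_real (gauss (sqrt 2 * s) x) * (of_real (gauss (s / sqrt 2) y) * wave (- (y \<bullet> \<omega>))) \<partial>lborel)"
    unfolding wigner_def z prod.case exp_eq_wave complex_cnj_complex_of_real of_real_mult[symmetric] prod
    by (simp add: mult.assoc)
  also have "\<dots> = of_real (gauss (sqrt 2 * s) x) * fourier (\<lambda>y. of_real (gauss (s / sqrt 2) y)) \<omega>"
    unfolding fourier_def by (rule integral_mult_right_zero)
  also have "\<dots> = of_real ((sqrt 2 / s) ^ CARD('d)) * of_real (gauss2 (sqrt 2 * s) (sqrt 2 / s) z)"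
    using s by (subst fourier_gauss) (simp_all add: gauss2_def z mult_ac)
  finally show "wigner (\<lambda>x :: real^'d. of_real (gauss s x)) z = \<dots>" .
qed

text \<open>The standard symplectic matrix:
  \<open>symplectic_form w v = v \<bullet> rotation w\<close>, so the symplectic transform at
  \<open>w\<close> is the ordinary one at \<open>rotation w\<close>.\<close>

definition rotation :: "'a::euclidean_space \<times> 'a \<Rightarrow> 'a \<times> 'a" where
  "rotation z = (snd z, - fst z)"

lemma measurable_rotation [measurable]: "rotation \<in> borel_measurable borel"
  unfolding rotation_def by (intro borel_measurable_continuous_onI continuous_intros)

lemma distr_rotation_lborel: "distr lborel borel rotation = (lborel :: ('a::euclidean_space \<times> 'a) measure)"
proof -
  have "(lborel :: ('a \<times> 'a) measure) = distr lborel borel (\<lambda>x. x) \<Otimes>\<^sub>M distr lborel borel uminus"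
    by (simp add: distr_uminus_lborel lborel_prod distr_id2)
  also have "\<dots> = distr (lborel \<Otimes>\<^sub>M lborel) (borel \<Otimes>\<^sub>M borel) (\<lambda>(x, y). (x, - y))"
    by (intro pair_measure_distr) (simp_all add: distr_uminus_lborel lborel.sigma_finite_measure_axioms)
  also have "\<dots> = distr lborel borel (\<lambda>z. (fst z, - snd z))"
    unfolding lborel_prod borel_prod by (intro distr_cong) auto
  also have "\<dots> = distr (distr lborel borel prod.swap) borel (\<lambda>z. (fst z, - snd z))"
    by (simp add: distr_swap_lborel)
  also have "\<dots> = distr lborel borel rotation"
    by (subst distr_distr) (auto simp: o_def rotation_def[abs_def] intro!: borel_measurable_continuous_onI continuous_intros)
  finally show ?thesis ..
qed

lemma integral_lborel_rotation:
  fixes f :: "'a::euclidean_space \<times> 'a \<Rightarrow> complex"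
  assumes [measurable]: "f \<in> borel_measurable borel"
  shows "(\<integral>z. f (rotation z) \<partial>lborel) = (\<integral>z. f z \<partial>lborel)"
  by (subst (2) distr_rotation_lborel[symmetric]) (simp add: integral_distr)

lemma measurable_Theta [measurable]: "Theta \<in> borel_measurable borel"
  unfolding Theta_def case_prod_beta by measurable

lemma Theta_rotation: "Theta (rotation w) = Theta w"
  by (simp add: Theta_def rotation_def case_prod_beta inner_commute)

text \<open>Unfolding the duality produces ordinary Fourier transforms at \<open>rotation w\<close>.
  Lebesgue measure and, as \<open>nsinc\<close> is even, \<open>Theta\<close> are invariant under
  \<open>rotation\<close>, so an ordinary Fourier multiplier remains.\<close>

lemma born_jordan_eq_inv_fourier:
  fixes f :: "real^'d \<Rightarrow> complex"
  assumes [measurable]: "wigner f \<in> borel_measurable borel"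
  shows "born_jordan n f = inv_fourier (\<lambda>\<eta>. Theta \<eta> ^ n * fourier (wigner f) \<eta>)"
proof
  fix z :: "(real^'d) \<times> (real^'d)"
  have sf: "symplectic_fourier (\<lambda>v. wigner f (z - v)) (- w) = wave (z \<bullet> rotation w) * fourier (wigner f) (rotation w)" for w
  proof -
    have "- symplectic_form (- w) v = v \<bullet> rotation w" for v
      by (simp add: symplectic_form_def rotation_def case_prod_beta inner_prod_def inner_commute)
    then have "symplectic_fourier (\<lambda>v. wigner f (z - v)) (- w) =
      (\<integral>v. (\<lambda>u. wave ((z - u) \<bullet> rotation w) * wigner f u) (z - v) \<partial>lborel)"
      unfolding symplectic_fourier_def exp_eq_wave by simp
    also have "\<dots> = (\<integral>u. wave ((z - u) \<bullet> rotation w) * wigner f u \<partial>lborel)"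
      by (rule integral_lborel_minus) measurable
    also have "\<dots> = (\<integral>u. wave (z \<bullet> rotation w) * (wigner f u * wave (- (u \<bullet> rotation w))) \<partial>lborel)"
      by (intro Bochner_Integration.integral_cong refl) (simp add: inner_diff_left wave_diff mult_ac)
    also have "\<dots> = wave (z \<bullet> rotation w) * fourier (wigner f) (rotation w)"
      unfolding fourier_def by (rule integral_mult_right_zero)
    finally show ?thesis .
  qed
  have "born_jordan n f z = (\<integral>w. (\<lambda>\<eta>. Theta \<eta> ^ n * fourier (wigner f) \<eta> * wave (z \<bullet> \<eta>)) (rotation w) \<partial>lborel)"
    unfolding born_jordan_def conv_distr_def symplectic_fourier_distr_def regular_distr_def sf
    by (simp add: Theta_rotation mult_ac)
  also have "\<dots> = inv_fourier (\<lambda>\<eta>. Theta \<eta> ^ n * fourier (wigner f) \<eta>) z"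
    unfolding inv_fourier_def by (rule integral_lborel_rotation) measurable
  finally show "born_jordan n f z = inv_fourier (\<lambda>\<eta>. Theta \<eta> ^ n * fourier (wigner f) \<eta>) z" .
qed

text \<open>Strictness persists for \<open>q2 = \<infinity>\<close>: the left side is then
  \<open>1 / 0 = 0\<close>, while \<open>q1\<close> is finite.\<close>

lemma inverse_exponent_less:
  assumes "1 \<le> q1" "q1 < q2"
  shows "1 / enn2real q2 < 1 / enn2real q1"
  using assms(1)
proof (cases rule: ennreal_exponent_cases)
  case (real Q)
  show ?thesis
  proof (cases q2)
    case top
    then show ?thesis using real by simp
  next
    case (real Q2)
    with \<open>q1 = ennreal Q\<close> \<open>1 \<le> Q\<close> assms(2) have "Q < Q2" by (simp add: ennreal_less_iff)
    then show ?thesis using real \<open>q1 = ennreal Q\<close> \<open>1 \<le> Q\<close> by (simp add: frac_less2)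
  qed
qed (use assms in auto)

theorem theorem1p5:
  fixes p q1 q2 :: ennreal and n :: nat and C :: real
    and g :: "(real^'d) \<times> (real^'d) \<Rightarrow> complex"
  assumes window: "schwartz g" "g \<noteq> (\<lambda>_. 0)"
    and exponents: "1 \<le> p" "1 \<le> q1" "1 \<le> q2"
    and order: "1 \<le> n"
    and C: "0 < C"
    and estimate: "\<And>f :: real^'d \<Rightarrow> complex. schwartz f \<Longrightarrow>
      modulation_norm g p q1 (regular_distr (born_jordan n f))
        \<le> ennreal C * modulation_norm g p q2 (regular_distr (wigner f))"
  shows "q2 \<le> q1"
proof (rule ccontr)
  assume "\<not> q2 \<le> q1"
  define r where "r = 1 / enn2real p"
  define r1 where "r1 = 1 / enn2real q1"
  define r2 where "r2 = 1 / enn2real q2"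
  have r: "r2 < r1" unfolding r1_def r2_def using \<open>\<not> q2 \<le> q1\<close> exponents by (intro inverse_exponent_less) auto
  let ?d = "CARD('d)"
  obtain b :: real where b: "1 \<le> b" "(\<integral>z. oscillation n (1 / (b * b)) 1 1 (z :: (real^'d) \<times> (real^'d)) \<partial>lborel) \<noteq> 0"
    by (rule oscillation_nonzero)
  \<comment> \<open>The factor with 1/2 comes from transforming the Wigner Gaussian, whose
    parameters multiply to 2; the factor with \<open>b\<close> comes from
    \<open>integral_oscillation_scale\<close>.\<close>
  define \<kappa> where "\<kappa> = (1 / 2) ^ ?d * (1 / (b * b)) ^ ?d * norm (\<integral>z. oscillation n (1 / (b * b)) 1 1 (z :: (real^'d) \<times> (real^'d)) \<partial>lborel)"
  have \<kappa>: "0 < \<kappa>" using b by (simp add: \<kappa>_def)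
  \<comment> \<open>Under multiplication of Gaussians the squared parameters add. Apart from powers
    of \<open>s\<close> they are 1/2 for the transformed Wigner Gaussian and \<open>1 / a^2\<close>
    for the test Gaussian, and \<open>a\<close> is solved so that they sum to
    \<open>b^2\<close>.\<close>
  define a where "a = 1 / sqrt (b\<^sup>2 - 1 / 2)"
  have b2: "1 \<le> b\<^sup>2" using b(1) by (intro one_le_power)
  then have a: "0 < a" by (simp add: a_def)
  have ab: "1 / 2 + 1 / a\<^sup>2 = b\<^sup>2" using b2 by (simp add: a_def power_divide)
  obtain K1 where K1: "0 < K1" "\<And>s m. 1 \<le> s \<Longrightarrow> integrable lborel m \<Longrightarrow>
    ennreal (norm (\<integral>\<eta>. m \<eta> * of_real (gauss2 (1 / (a * s)) (1 / (a / s)) \<eta>) \<partial>lborel))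
      \<le> ennreal (K1 * (s ^ ?d) powr (1 - r - r1)) * modulation_norm g p q1 (regular_distr (inv_fourier m))"
    using pairing_le_modulation_norm[OF window a exponents(1,2)] unfolding r_def r1_def by auto
  obtain K2 where K2: "0 < K2" "\<And>s A. 1 \<le> s \<Longrightarrow> 0 < A \<Longrightarrow>
    modulation_norm g p q2 (regular_distr (\<lambda>y. of_real A * of_real (gauss2 (sqrt 2 * s) (sqrt 2 / s) y)))
      \<le> ennreal (A * (K2 * (s ^ ?d) powr (r + r2 - 1)))"
    using modulation_norm_gauss2_le[OF window(1) _ exponents(1,3), of "sqrt 2"] unfolding r_def r2_def by auto
  define K where "K = K1 * C * K2 / \<kappa>"
  have K: "0 < K" using K1(1) K2(1) C \<kappa> by (simp add: K_def)
  have main: "s powr (r1 - r2) \<le> K" if s: "1 \<le> s" for s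
  proof -
    define S where "S = s ^ ?d"
    \<comment> \<open>The dimension is at least 1; this converts the final bound from
      \<open>S\<close> to \<open>s\<close>.\<close>
    have sS: "s \<le> S" unfolding S_def using s power_increasing[of 1 ?d s] by (simp add: Suc_le_eq)
    then have S: "0 < S" using s by simp
    define A where "A = (sqrt 2 / s) ^ ?d"
    have A: "0 < A" using s by (simp add: A_def)
    define f where "f = (\<lambda>x::real^'d. complex_of_real (gauss s x))"
    have W: "wigner f = (\<lambda>z. of_real A * of_real (gauss2 (sqrt 2 * s) (sqrt 2 / s) z))"
      unfolding f_def A_def using s by (intro wigner_gauss) auto
    have [measurable]: "wigner f \<in> borel_measurable borel" unfolding W by measurable
    define m where "m = (\<lambda>\<eta>. Theta \<eta> ^ n * fourier (wigner f) \<eta>)"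
    have m_eq: "m \<eta> = of_real (A * (1 / 2) ^ ?d) * oscillation n 1 (1 / (sqrt 2 * s)) (s / sqrt 2) \<eta>" for \<eta>
      unfolding m_def W fourier_cmult using s
      by (subst fourier_gauss2) (auto simp: oscillation_def Theta_def case_prod_beta)
    have m: "integrable lborel m"
      unfolding m_eq[abs_def] using s by (intro integrable_mult_right integrable_oscillation) auto
    have "sqrt ((1 / (sqrt 2 * s))\<^sup>2 + (1 / (a * s))\<^sup>2) = sqrt ((1 / 2 + 1 / a\<^sup>2) * (1 / s)\<^sup>2)"
      by (simp add: power_mult_distrib power_divide add_divide_distrib)
    then have t: "sqrt ((1 / (sqrt 2 * s))\<^sup>2 + (1 / (a * s))\<^sup>2) = b / s"
      unfolding ab using b(1) s by (simp add: real_sqrt_mult)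
    have "sqrt ((s / sqrt 2)\<^sup>2 + (1 / (a / s))\<^sup>2) = sqrt ((1 / 2 + 1 / a\<^sup>2) * s\<^sup>2)"
      by (simp add: power_mult_distrib power_divide distrib_right)
    then have u: "sqrt ((s / sqrt 2)\<^sup>2 + (1 / (a / s))\<^sup>2) = b * s"
      unfolding ab using b(1) s by (simp add: real_sqrt_mult)
    have "m \<eta> * of_real (gauss2 (1 / (a * s)) (1 / (a / s)) \<eta>) = of_real (A * (1 / 2) ^ ?d) * oscillation n 1 (b / s) (b * s) \<eta>" for \<eta>
      unfolding m_eq t[symmetric] u[symmetric] oscillation_def gauss2_mult[symmetric] by (simp add: mult_ac)
    then have "(\<integral>\<eta>. m \<eta> * of_real (gauss2 (1 / (a * s)) (1 / (a / s)) \<eta>) \<partial>lborel) =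
      of_real (A * (1 / 2) ^ ?d) * (\<integral>\<eta>. oscillation n 1 (b / s) (b * s) (\<eta> :: (real^'d) \<times> (real^'d)) \<partial>lborel)"
      by (simp only: integral_mult_right_zero)
    also have "\<dots> = of_real (A * (1 / 2) ^ ?d) * (of_real ((1 / (b * b)) ^ ?d) *
        (\<integral>\<eta>. oscillation n (1 / (b * b)) 1 1 (\<eta> :: (real^'d) \<times> (real^'d)) \<partial>lborel))"
      using b(1) s by (subst integral_oscillation_scale) auto
    finally have "norm (\<integral>\<eta>. m \<eta> * of_real (gauss2 (1 / (a * s)) (1 / (a / s)) \<eta>) \<partial>lborel) = A * \<kappa>"
      using A b(1) by (simp only: norm_mult norm_of_real \<kappa>_def) (simp add: abs_of_pos)
    with K1(2)[OF s m] have "ennreal (A * \<kappa>) \<le> ennreal (K1 * S powr (1 - r - r1)) * modulation_norm g p q1 (regular_distr (inv_fourier m))"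
      by (simp add: S_def)
    also have "inv_fourier m = born_jordan n f"
      unfolding m_def by (rule born_jordan_eq_inv_fourier[symmetric]) measurable
    also have "ennreal (K1 * S powr (1 - r - r1)) * modulation_norm g p q1 (regular_distr (born_jordan n f)) \<le>
       ennreal (K1 * S powr (1 - r - r1)) * (ennreal C * ennreal (A * (K2 * S powr (r + r2 - 1))))"
    proof (intro mult_left_mono order_trans[OF estimate])
      show "schwartz f" unfolding f_def using s by (intro schwartz_gauss) auto
      show "modulation_norm g p q2 (regular_distr (wigner f)) \<le> ennreal (A * (K2 * S powr (r + r2 - 1)))"
        unfolding W S_def by (rule K2(2)[OF s A])
    qed auto
    also have "\<dots> = ennreal (A * (K1 * C * K2 * (S powr (1 - r - r1) * S powr (r + r2 - 1))))"
      using K1(1) K2(1) C A by (simp add: mult_ac flip: ennreal_mult)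
    \<comment> \<open>The contribution \<open>r\<close> of \<open>p\<close> cancels here, and the
      common amplitude \<open>A\<close> is divided out next.\<close>
    also have "S powr (1 - r - r1) * S powr (r + r2 - 1) = S powr (r2 - r1)" by (simp flip: powr_add)
    finally have "A * \<kappa> \<le> A * (K1 * C * K2 * S powr (r2 - r1))"
      using K1(1) K2(1) C A by (subst (asm) ennreal_le_iff) auto
    then have "\<kappa> \<le> K1 * C * K2 * S powr (r2 - r1)" using A by simp
    then have "\<kappa> * S powr (r1 - r2) \<le> K1 * C * K2 * S powr (r2 - r1) * S powr (r1 - r2)"
      by (rule mult_right_mono) simp
    also have "\<dots> = K1 * C * K2" using S by (simp add: mult.assoc flip: powr_add)
    finally have "S powr (r1 - r2) \<le> K" using \<kappa> by (simp add: K_def le_divide_eq mult.commute)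
    moreover have "s powr (r1 - r2) \<le> S powr (r1 - r2)" using r s sS by (intro powr_mono2) auto
    ultimately show ?thesis by linarith
  qed
  \<comment> \<open>The witness for \<open>s\<close> is at least 1 and makes the left side equal to
    \<open>K + 1\<close>.\<close>
  have "((K + 1) powr (1 / (r1 - r2))) powr (r1 - r2) \<le> K"
    using r K by (intro main ge_one_powr_ge_zero) auto
  then show False using r K by (simp add: powr_powr)
qed

end
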